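(* Every $(4k-1)$-edge-connected essentially $(6k-7)$-edge-connected graph with $k\ge 3$ admits a bipartite modulo $k$-regular factor. In addition, this result is true for bipartite $2k$-edge-connected essentially $(3k-3)$-edge-connected graphs (that is, every such graph with $k\ge 3$ admits a bipartite modulo $k$-regular factor).
   Context: Here $k$ is an integer, and graphs may have loops and multiple edges. A graph $G$ is $\lambda$-edge-connected if, for every nonempty proper subset $A$ of its vertex set, at least $\lambda$ edges have exactly one end in $A$. A graph is essentially $\lambda$-edge-connected if all edges of any edge cut of size strictly less than $\lambda$ are incident with a common vertex. A factor is a spanning subgraph. A modulo $k$-regular graph is a graph whose vertex degrees are positive and divisible by $k$. *)

theory Defs
  imports Main "HOL-Library.Multiset"
begin

text \<open>
  Undirected graphs with loops and multiple edges. Edges have identities of their own, and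
  each is assigned the two-element multiset of its ends; a loop at \<open>v\<close> has ends \<open>{#v, v#}\<close>.
\<close>

record ('v, 'e) graph =
  verts :: "'v set"
  edges :: "'e set"
  ends :: "'e \<Rightarrow> 'v multiset"

definition multigraph :: "('v, 'e) graph \<Rightarrow> bool" where
  "multigraph G \<longleftrightarrow> finite (verts G) \<and> finite (edges G) \<and>
     (\<forall>e \<in> edges G. size (ends G e) = 2 \<and> set_mset (ends G e) \<subseteq> verts G)"

text \<open>A loop contributes 2 to the degree of its vertex.\<close>

definition degree :: "('v, 'e) graph \<Rightarrow> 'v \<Rightarrow> nat" where
  "degree G v = (\<Sum>e \<in> edges G. count (ends G e) v)"

definition edge_cut :: "('v, 'e) graph \<Rightarrow> 'v set \<Rightarrow> 'e set" where
  "edge_cut G A = {e \<in> edges G. \<exists>u w. ends G e = {#u, w#} \<and> u \<in> A \<and> w \<notin> A}"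

text \<open>Vacuously, a graph with a single vertex is \<open>l\<close>-edge-connected for every \<open>l\<close>.\<close>

definition edge_connected :: "nat \<Rightarrow> ('v, 'e) graph \<Rightarrow> bool" where
  "edge_connected l G \<longleftrightarrow> (\<forall>A. A \<noteq> {} \<and> A \<subset> verts G \<longrightarrow> l \<le> card (edge_cut G A))"

definition essentially_edge_connected :: "nat \<Rightarrow> ('v, 'e) graph \<Rightarrow> bool" where
  "essentially_edge_connected l G \<longleftrightarrow>
     (\<forall>A. A \<noteq> {} \<and> A \<subset> verts G \<and> card (edge_cut G A) < l \<longrightarrow>
       (\<exists>v \<in> verts G. \<forall>e \<in> edge_cut G A. v \<in># ends G e))"

definition bipartite :: "('v, 'e) graph \<Rightarrow> bool" where
  "bipartite G \<longleftrightarrow> (\<exists>X Y. X \<union> Y = verts G \<and> X \<inter> Y = {} \<and>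
     (\<forall>e \<in> edges G. \<exists>x \<in> X. \<exists>y \<in> Y. ends G e = {#x, y#}))"

definition factor_of :: "('v, 'e) graph \<Rightarrow> ('v, 'e) graph \<Rightarrow> bool" where
  "factor_of H G \<longleftrightarrow> multigraph H \<and> verts H = verts G \<and> edges H \<subseteq> edges G \<and>
     (\<forall>e \<in> edges H. ends H e = ends G e)"

definition modulo_regular :: "nat \<Rightarrow> ('v, 'e) graph \<Rightarrow> bool" where
  "modulo_regular k G \<longleftrightarrow> (\<forall>v \<in> verts G. 0 < degree G v \<and> k dvd degree G v)"

end

theory Submission
  imports Defs
begin

text \<open>
  In a bipartite graph with parts \<open>X\<close> and \<open>Y\<close>, orienting the edges of a factor from \<open>X\<close> to \<open>Y\<close>
  and all other edges from \<open>Y\<close> to \<open>X\<close> turns modulo \<open>k\<close>-regular factors into orientations with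
  prescribed net outdegrees modulo \<open>2k\<close>; the general case reduces to the bipartite one by passing
  to a maximum cut, which keeps at least half of every edge cut.  Such orientations are found by
  the inductive method of Lovasz, Thomassen, Wu and Zhang.  A special vertex \<open>z\<close> has
  all its edges oriented in advance, and every other vertex set \<open>A\<close> must admit a net outdegree of the
  right residue that leaves at least \<open>k - 1\<close> edges in each direction.  If \<open>A\<close> has no room for \<open>k\<close>
  edges in each direction, the two sides of the cut are solved one after the other by contraction.
  Otherwise all such sets have room to spare, and one may lift a pair of edges at a vertex or
  orient and delete a single edge.  Deletion gets stuck only when every vertex can spare outgoing
  edges but no incoming ones (or vice versa).  Then all edges from other vertices to \<open>z\<close> can be
  dropped one by one, after which fewer than \<open>k\<close> new edges from a vertex \<open>y\<close> to \<open>z\<close> allow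
  \<open>y\<close> to spare an incoming edge.
\<close>

section \<open>Orientations with prescribed boundary edges\<close>

text \<open>The residues alone would allow a vertex of degree 0 in the factor. Positivity is
  therefore carried as a requirement on the marked set \<open>S\<close>, which is all of
  \<open>W\<close> at the start. Lifting at a marked vertex leads a directed path through it and so
  settles its mark. Edges are deleted only when no mark is left, so deletion never has to protect
  one. The connectivity constants are those that make the start admissible with \<open>z\<close>
  isolated. Degree 2k gives every vertex slack \<open>2 * k\<close>. For other sets, the demanded
  residue modulo 2k has a representative of absolute value at most k, and by parity this fits into a
  cut of 3k - 3 edges with slack \<open>2 * k - 2\<close>. A smaller cut with two vertices on either
  side makes the common end of its edges a cut vertex. There the graph is split and the parts are
  solved independently: the degrees at the cut vertex add up, and sums of positive multiples of k
  are again such.\<close>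

definition cut_weight :: "('v \<Rightarrow> 'v \<Rightarrow> int) \<Rightarrow> 'v set \<Rightarrow> 'v set \<Rightarrow> int" where
  "cut_weight m A B = (\<Sum>u\<in>A. \<Sum>v\<in>B. m u v)"

text \<open>
  The special vertex \<open>z\<close> is not an element of \<open>W\<close>: it is represented by the numbers \<open>P v\<close> of edges
  oriented from \<open>z\<close> to \<open>v\<close> and \<open>R v\<close> of edges oriented from \<open>v\<close> to \<open>z\<close>.
\<close>

definition boundary_degree :: "'v set \<Rightarrow> ('v \<Rightarrow> 'v \<Rightarrow> int) \<Rightarrow> ('v \<Rightarrow> int) \<Rightarrow> ('v \<Rightarrow> int) \<Rightarrow> 'v set \<Rightarrow> int" where
  "boundary_degree W m P R A = cut_weight m A (W - A) + sum P A + sum R A"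

text \<open>
  \<open>T\<close> is a net outdegree of \<open>A\<close>, edges at \<open>z\<close> included. The slack \<open>j = 2 * k - 2\<close> means that at
  least \<open>k - 1\<close> edges leave \<open>A\<close> and at least \<open>k - 1\<close> enter it, the slack \<open>j = 2 * k\<close> that at least
  \<open>k\<close> do.
\<close>

definition feasible :: "int \<Rightarrow> 'v set \<Rightarrow> ('v \<Rightarrow> 'v \<Rightarrow> int) \<Rightarrow> ('v \<Rightarrow> int) \<Rightarrow> ('v \<Rightarrow> int) \<Rightarrow> ('v \<Rightarrow> int) \<Rightarrow> int \<Rightarrow> 'v set \<Rightarrow> bool" where
  "feasible k W m P R t j A \<longleftrightarrow> (\<exists>T. 2 * k dvd T - sum t A \<and> \<bar>T\<bar> \<le> boundary_degree W m P R A - j)"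

text \<open>
  This is what is known about the edges at \<open>z\<close> when \<open>W\<close> arises as a set without slack \<open>2 * k\<close>.
\<close>

definition in_bounds :: "int \<Rightarrow> int \<Rightarrow> int \<Rightarrow> bool" where
  "in_bounds k p r \<longleftrightarrow> p \<le> 2 * k - 1 \<and> r \<le> k - 1 \<or> p \<le> k - 1 \<and> r \<le> 2 * k - 1"

text \<open>
  \<open>t v\<close> is the demanded net outdegree modulo \<open>2 * k\<close>, edges at \<open>z\<close> included. The set \<open>X\<close> contains
  at most one vertex, which is exempt from the degree condition because its edges are being lifted
  until it can be merged into \<open>z\<close>. The vertices in \<open>S\<close> have to receive both an incoming and an
  outgoing edge.
\<close>

definition admissible :: "int \<Rightarrow> 'v set \<Rightarrow> ('v \<Rightarrow> 'v \<Rightarrow> int) \<Rightarrow> ('v \<Rightarrow> int) \<Rightarrow> ('v \<Rightarrow> int) \<Rightarrow> ('v \<Rightarrow> int) \<Rightarrow> 'v set \<Rightarrow> 'v set \<Rightarrow> bool" where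
  "admissible k W m P R t X S \<longleftrightarrow> finite W \<and> W \<noteq> {} \<and>
     (\<forall>u v. m u v = m v u) \<and> (\<forall>u v. 0 \<le> m u v) \<and> (\<forall>v. m v v = 0) \<and>
     (\<forall>v\<in>W. 0 \<le> P v \<and> 0 \<le> R v) \<and>
     (\<forall>v\<in>W. even (t v - boundary_degree W m P R {v})) \<and>
     2 * k dvd sum t W + sum P W - sum R W \<and> in_bounds k (sum P W) (sum R W) \<and>
     (\<forall>A. A \<noteq> {} \<and> A \<subset> W \<and> (\<forall>v\<in>X. A \<noteq> {v}) \<longrightarrow> feasible k W m P R t (2 * k - 2) A) \<and>
     (\<forall>v\<in>X. X = {v} \<and> v \<in> W \<and> S = {} \<and> 2 * k dvd t v) \<and>
     S \<subseteq> W \<and> (\<forall>v\<in>S. feasible k W m P R t (2 * k) {v})"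

definition orients :: "'v set \<Rightarrow> ('v \<Rightarrow> 'v \<Rightarrow> int) \<Rightarrow> ('v \<Rightarrow> 'v \<Rightarrow> int) \<Rightarrow> bool" where
  "orients W m f \<longleftrightarrow> (\<forall>u\<in>W. \<forall>v\<in>W. 0 \<le> f u v \<and> f u v + f v u = m u v)"

definition net_outdegree :: "'v set \<Rightarrow> ('v \<Rightarrow> 'v \<Rightarrow> int) \<Rightarrow> 'v \<Rightarrow> int" where
  "net_outdegree W f v = (\<Sum>u\<in>W. f v u - f u v)"

definition solvable :: "int \<Rightarrow> 'v set \<Rightarrow> ('v \<Rightarrow> 'v \<Rightarrow> int) \<Rightarrow> ('v \<Rightarrow> int) \<Rightarrow> ('v \<Rightarrow> int) \<Rightarrow> ('v \<Rightarrow> int) \<Rightarrow> 'v set \<Rightarrow> bool" where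
  "solvable k W m P R t S \<longleftrightarrow> (\<exists>f. orients W m f \<and>
     (\<forall>v\<in>W. 2 * k dvd net_outdegree W f v - P v + R v - t v) \<and>
     (\<forall>v\<in>S. \<bar>net_outdegree W f v - P v + R v\<bar> \<le> boundary_degree W m P R {v} - 2))"

text \<open>The part of the induction hypothesis that most reductions share. On the same
  \<open>W\<close> only the edges inside \<open>W\<close> are compared, so a step that removes one
  of them is free to change the edges at \<open>z\<close>, even to add some.\<close>

definition smaller_solved :: "int \<Rightarrow> 'v set \<Rightarrow> ('v \<Rightarrow> 'v \<Rightarrow> int) \<Rightarrow> bool" where
  "smaller_solved k W m \<longleftrightarrow>
     (\<forall>(W' :: 'v set) m' P R t X S. admissible k W' m' P R t X S \<and> card W' < card W \<longrightarrow> solvable k W' m' P R t S) \<and>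
     (\<forall>m' P R t X S. admissible k W m' P R t X S \<and> cut_weight m' W W < cut_weight m W W \<longrightarrow> solvable k W m' P R t S)"

section \<open>Cut weights and net outdegrees under changes of single edges\<close>

lemma cut_weight_sym: "(\<And>u v. m u v = m v u) \<Longrightarrow> cut_weight m A B = cut_weight m B A"
  unfolding cut_weight_def by (subst sum.swap) simp

lemma cut_weight_nonneg: "(\<And>u v. 0 \<le> m u v) \<Longrightarrow> 0 \<le> cut_weight m A B"
  unfolding cut_weight_def by (simp add: sum_nonneg)

lemma cut_weight_Un_left: "finite A \<Longrightarrow> finite B \<Longrightarrow> A \<inter> B = {} \<Longrightarrow> cut_weight m (A \<union> B) C = cut_weight m A C + cut_weight m B C"
  unfolding cut_weight_def by (rule sum.union_disjoint)

lemma cut_weight_Un_right: "finite B \<Longrightarrow> finite C \<Longrightarrow> B \<inter> C = {} \<Longrightarrow> cut_weight m A (B \<union> C) = cut_weight m A B + cut_weight m A C"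
  unfolding cut_weight_def by (simp add: sum.union_disjoint sum.distrib)

lemma cut_weight_add: "cut_weight (\<lambda>u v. m u v + n u v) A B = cut_weight m A B + cut_weight n A B"
  unfolding cut_weight_def by (simp add: sum.distrib)

lemma cut_weight_scale: "cut_weight (\<lambda>u v. c * m u v) A B = c * cut_weight m A B"
  unfolding cut_weight_def by (simp add: sum_distrib_left)

lemma cut_weight_self_even:
  assumes "finite A" "\<And>u v. m u v = m v u" "\<And>v. m v v = 0"
  shows "even (cut_weight m A A)"
  using assms(1)
proof induction
  case empty then show ?case by (simp add: cut_weight_def)
next
  case (insert x A)
  have "cut_weight m (insert x A) (insert x A) = cut_weight m ({x} \<union> A) ({x} \<union> A)" by simp
  also have "\<dots> = cut_weight m {x} {x} + cut_weight m {x} A + (cut_weight m A {x} + cut_weight m A A)"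
    using insert by (simp add: cut_weight_Un_left cut_weight_Un_right del: insert_is_Un[symmetric] Un_insert_left)
  also have "cut_weight m A {x} = cut_weight m {x} A" using assms(2) by (rule cut_weight_sym)
  also have "cut_weight m {x} {x} = 0" using assms(3) by (simp add: cut_weight_def)
  finally show ?case using insert by simp
qed

text \<open>The multiplicity function of a single edge. Liftings and deletions add multiples of it
  to \<open>m\<close>, so their effect on every cut follows by linearity.\<close>

definition edge_unit :: "'v \<Rightarrow> 'v \<Rightarrow> 'v \<Rightarrow> 'v \<Rightarrow> int" where
  "edge_unit x y u v = of_bool (u = x \<and> v = y) + of_bool (u = y \<and> v = x)"

lemma sum_of_bool_eq: "finite A \<Longrightarrow> (\<Sum>v\<in>A. of_bool (v = x)) = (of_bool (x \<in> A) :: int)"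
  by (simp add: of_bool_def sum.delta)

lemma cut_weight_arc: "finite A \<Longrightarrow> finite B \<Longrightarrow>
  cut_weight (\<lambda>u v. of_bool (u = x \<and> v = y)) A B = of_bool (x \<in> A \<and> y \<in> B)"
  by (simp add: cut_weight_def of_bool_conj sum_of_bool_eq flip: sum_distrib_left sum_distrib_right)

lemma cut_weight_edge_unit: "finite A \<Longrightarrow> finite B \<Longrightarrow>
  cut_weight (edge_unit x y) A B = of_bool (x \<in> A \<and> y \<in> B) + of_bool (y \<in> A \<and> x \<in> B)"
  by (simp add: edge_unit_def[abs_def] cut_weight_add cut_weight_arc)

lemma boundary_degree_add_edge_unit:
  assumes "finite W" "A \<subseteq> W" "x \<in> W" "y \<in> W"
  shows "boundary_degree W (\<lambda>u v. m u v + c * edge_unit x y u v) P R A = boundary_degree W m P R A + c * of_bool ((x \<in> A) \<noteq> (y \<in> A))"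
proof -
  have "finite A" using assms finite_subset by blast
  then show ?thesis using assms
    by (auto simp: boundary_degree_def cut_weight_add cut_weight_scale cut_weight_edge_unit algebra_simps)
qed

lemma sum_point: "finite A \<Longrightarrow> (\<Sum>v\<in>A. P v + c * of_bool (v = x)) = sum P A + c * (of_bool (x \<in> A) :: int)"
  by (simp add: sum.distrib sum_of_bool_eq flip: sum_distrib_left)

lemma boundary_degree_add_P: "finite A \<Longrightarrow> boundary_degree W m (\<lambda>v. P v + c * of_bool (v = x)) R A = boundary_degree W m P R A + c * of_bool (x \<in> A)"
  by (simp add: boundary_degree_def sum_point)

lemma boundary_degree_add_R: "finite A \<Longrightarrow> boundary_degree W m P (\<lambda>v. R v + c * of_bool (v = x)) A = boundary_degree W m P R A + c * of_bool (x \<in> A)"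
  by (simp add: boundary_degree_def sum_point)

lemma net_outdegree_add: "net_outdegree W (\<lambda>u v. f u v + c * of_bool (u = x \<and> v = y)) w =
   net_outdegree W f w + c * (of_bool (w = x) * of_bool (y \<in> W) - of_bool (w = y) * of_bool (x \<in> W))"
  if "finite W"
  using that by (simp add: net_outdegree_def of_bool_conj sum.distrib sum_subtractf algebra_simps sum_of_bool_eq flip: sum_distrib_left)

text \<open>Meant for the graph after a lifting at \<open>v\<close>: the boundary degree has dropped
  by 2 there, so this trivial bound is exactly the bound with \<open>- 2\<close> that a mark demands
  in the original graph.\<close>

lemma net_outdegree_bound:
  assumes "orients W m f" "v \<in> W" "finite W" "m v v = 0" "0 \<le> P v" "0 \<le> R v"
  shows "\<bar>net_outdegree W f v - P v + R v\<bar> \<le> boundary_degree W m P R {v}"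
proof -
  have "boundary_degree W m P R {v} = (\<Sum>u\<in>W. m v u) + P v + R v"
    using assms(2,3,4) by (simp add: boundary_degree_def cut_weight_def sum_diff1)
  moreover have "(\<Sum>u\<in>W. m v u) = (\<Sum>u\<in>W. f v u) + (\<Sum>u\<in>W. f u v)"
    using assms(1,2) by (simp add: orients_def sum.distrib[symmetric])
  moreover have "0 \<le> (\<Sum>u\<in>W. f v u)" "0 \<le> (\<Sum>u\<in>W. f u v)"
    using assms(1,2) by (auto simp: orients_def intro!: sum_nonneg)
  ultimately show ?thesis using assms(5,6) by (simp add: net_outdegree_def sum_subtractf)
qed

lemma boundary_degree_single: "finite W \<Longrightarrow> m v v = 0 \<Longrightarrow> v \<in> W \<Longrightarrow> boundary_degree W m P R {v} = (\<Sum>u\<in>W. m v u) + P v + R v"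
  by (simp add: boundary_degree_def cut_weight_def sum_diff1)

lemma admissibleD:
  assumes "admissible k W m P R t X S"
  shows "finite W" "W \<noteq> {}" "m u v = m v u" "0 \<le> m u v" "m v v = 0"
    "v \<in> W \<Longrightarrow> 0 \<le> P v" "v \<in> W \<Longrightarrow> 0 \<le> R v"
    "v \<in> W \<Longrightarrow> even (t v - boundary_degree W m P R {v})"
    "2 * k dvd sum t W + sum P W - sum R W" "in_bounds k (sum P W) (sum R W)"
    "A \<noteq> {} \<Longrightarrow> A \<subset> W \<Longrightarrow> (\<And>v. v \<in> X \<Longrightarrow> A \<noteq> {v}) \<Longrightarrow> feasible k W m P R t (2 * k - 2) A"
    "v \<in> X \<Longrightarrow> X = {v}" "v \<in> X \<Longrightarrow> v \<in> W" "v \<in> X \<Longrightarrow> S = {}" "v \<in> X \<Longrightarrow> 2 * k dvd t v"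
    "S \<subseteq> W" "v \<in> S \<Longrightarrow> feasible k W m P R t (2 * k) {v}"
  using assms unfolding admissible_def by simp_all

lemma admissibleI:
  assumes "finite W" "W \<noteq> {}" "\<And>u v. m u v = m v u" "\<And>u v. 0 \<le> m u v" "\<And>v. m v v = 0"
    "\<And>v. v \<in> W \<Longrightarrow> 0 \<le> P v" "\<And>v. v \<in> W \<Longrightarrow> 0 \<le> R v"
    "\<And>v. v \<in> W \<Longrightarrow> even (t v - boundary_degree W m P R {v})"
    "2 * k dvd sum t W + sum P W - sum R W" "in_bounds k (sum P W) (sum R W)"
    "\<And>A. A \<noteq> {} \<Longrightarrow> A \<subset> W \<Longrightarrow> (\<And>v. v \<in> X \<Longrightarrow> A \<noteq> {v}) \<Longrightarrow> feasible k W m P R t (2 * k - 2) A"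
    "\<And>v. v \<in> X \<Longrightarrow> X = {v} \<and> v \<in> W \<and> S = {} \<and> 2 * k dvd t v"
    "S \<subseteq> W" "\<And>v. v \<in> S \<Longrightarrow> feasible k W m P R t (2 * k) {v}"
  shows "admissible k W m P R t X S"
proof -
  have "\<forall>A. A \<noteq> {} \<and> A \<subset> W \<and> (\<forall>v\<in>X. A \<noteq> {v}) \<longrightarrow> feasible k W m P R t (2 * k - 2) A"
    using assms(11) by blast
  then show ?thesis
    unfolding admissible_def using assms(1-10,12-14) by simp
qed

text \<open>Summing the parity condition over the vertices of \<open>A\<close> counts every edge
  inside \<open>A\<close> twice.\<close>

lemma parity_set:
  assumes I: "admissible k W m P R t X S" and A: "A \<subseteq> W"
  shows "even (sum t A - boundary_degree W m P R A)"
proof -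
  have fW: "finite W" and sym: "\<And>u v. m u v = m v u" and dg: "\<And>v. m v v = 0"
    using admissibleD[OF I] by simp_all
  have fA: "finite A" using A fW finite_subset by blast
  have "(\<Sum>v\<in>A. boundary_degree W m P R {v}) = (\<Sum>v\<in>A. (\<Sum>u\<in>W. m v u) + P v + R v)"
    using A fW dg by (intro sum.cong) (auto simp: boundary_degree_single)
  also have "\<dots> = cut_weight m A W + sum P A + sum R A"
    by (simp add: cut_weight_def sum.distrib)
  also have "cut_weight m A W = cut_weight m A (A \<union> (W - A))"
    using A by (simp add: Un_absorb1)
  also have "\<dots> = cut_weight m A A + cut_weight m A (W - A)"
    using fA fW by (intro cut_weight_Un_right) auto
  finally have "(\<Sum>v\<in>A. boundary_degree W m P R {v}) = cut_weight m A A + boundary_degree W m P R A"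
    by (simp add: boundary_degree_def)
  moreover have "even (\<Sum>v\<in>A. t v - boundary_degree W m P R {v})"
    using admissibleD(8)[OF I] A by (intro dvd_sum) auto
  ultimately show ?thesis
    using cut_weight_self_even[OF fA sym dg] by (simp add: sum_subtractf)
qed

text \<open>The whole of \<open>W\<close> never has slack \<open>2 * k\<close>. With T = r - p +
  2kj, such slack would give k(j + 1) \<le> p and k(1 - j) \<le> r. So p or r would be at least 2k,
  or both would be at least k.\<close>

lemma in_bounds_tight:
  assumes "in_bounds k p r" "2 * k dvd T - (r - p)" "0 \<le> p" "0 \<le> r" "0 < k"
  shows "p + r - 2 * k < \<bar>T\<bar>"
proof (rule ccontr)
  assume "\<not> ?thesis"
  then have T: "\<bar>T\<bar> \<le> p + r - 2 * k" by simp
  obtain j where j: "T = r - p + 2 * k * j" using assms(2) by (metis dvdE add.commute diff_add_cancel)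
  have 1: "k * j \<le> p - k" "k * (1 - j) \<le> r" using T j by (auto simp: algebra_simps)
  then have 2: "k * (j + 1) \<le> p" by (simp add: algebra_simps)
  show False
  proof (cases "j \<le> 0")
    case True
    then have "k * 1 \<le> k * (1 - j)" using assms(5) by (intro mult_left_mono) auto
    then have r: "k \<le> r" using 1 by simp
    then have p: "p \<le> k - 1" using assms(1) by (auto simp: in_bounds_def)
    have "k * (j + 1) < k * 1" using 2 p by linarith
    then have "j + 1 < 1" using mult_less_cancel_left_pos[OF assms(5)] by blast
    then have "j \<le> -1" by simp
    then have "k * 2 \<le> k * (1 - j)" using assms(5) by (intro mult_left_mono) auto
    then show False using 1 assms(1) r unfolding in_bounds_def by linarith
  next
    case False
    then have "k * 2 \<le> k * (j + 1)" using assms(5) by (intro mult_left_mono) auto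
    then show False using 2 assms(1) assms(5) unfolding in_bounds_def by linarith
  qed
qed

section \<open>Reversal of all arcs\<close>

lemma boundary_degree_swap: "boundary_degree W m R P A = boundary_degree W m P R A"
  by (simp add: boundary_degree_def)

lemma feasible_swap:
  assumes "feasible k W m P R t j A"
  shows "feasible k W m R P (\<lambda>v. - t v) j A"
proof -
  obtain T where "2 * k dvd T - sum t A" "\<bar>T\<bar> \<le> boundary_degree W m P R A - j"
    using assms by (auto simp: feasible_def)
  then have "2 * k dvd - T - (\<Sum>v\<in>A. - t v)" "\<bar>- T\<bar> \<le> boundary_degree W m R P A - j"
    using dvd_minus_iff[of "2 * k" "T - sum t A"] by (simp_all add: sum_negf boundary_degree_swap algebra_simps)
  then show ?thesis by (auto simp: feasible_def)
qed

text \<open>Reversing every arc exchanges the two kinds of edges at \<open>z\<close> and negates all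
  demands. Later case distinctions between incoming and outgoing edges need only one half.\<close>

lemma admissible_swap:
  assumes I: "admissible k W m P R t X S"
  shows "admissible k W m R P (\<lambda>v. - t v) X S"
proof -
  note D = admissibleD[OF I]
  have "2 * k dvd (\<Sum>v\<in>W. - t v) + sum R W - sum P W"
    using D(9) dvd_minus_iff[of "2 * k" "sum t W + sum P W - sum R W"] by (simp add: sum_negf algebra_simps)
  moreover have "in_bounds k (sum R W) (sum P W)" using D(10) by (auto simp: in_bounds_def)
  moreover have "even (- t v - boundary_degree W m R P {v})" if "v \<in> W" for v
    using D(8)[OF that] by (simp add: boundary_degree_swap)
  ultimately show ?thesis
    using D by (intro admissibleI feasible_swap) simp_all
qed

lemma solvable_swap:
  assumes "solvable k W m R P (\<lambda>v. - t v) S"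
  shows "solvable k W m P R t S"
proof -
  obtain f where f: "orients W m f" "\<And>v. v \<in> W \<Longrightarrow> 2 * k dvd net_outdegree W f v - R v + P v - - t v"
    "\<And>v. v \<in> S \<Longrightarrow> \<bar>net_outdegree W f v - R v + P v\<bar> \<le> boundary_degree W m R P {v} - 2"
    using assms by (auto simp: solvable_def)
  define g where "g u v = f v u" for u v
  have n: "net_outdegree W g v = - net_outdegree W f v" for v
    by (simp add: net_outdegree_def g_def sum_subtractf)
  have "2 * k dvd net_outdegree W g v - P v + R v - t v" if "v \<in> W" for v
    using f(2)[OF that] dvd_minus_iff[of "2 * k" "net_outdegree W f v - R v + P v - - t v"]
    by (simp add: n algebra_simps)
  moreover have "\<bar>net_outdegree W g v - P v + R v\<bar> \<le> boundary_degree W m P R {v} - 2" if "v \<in> S" for v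
    using f(3)[OF that] by (simp add: n boundary_degree_swap abs_if split: if_splits)
  moreover have "orients W m g"
    using f(1) by (auto simp: orients_def g_def add.commute)
  ultimately show ?thesis by (auto simp: solvable_def)
qed

section \<open>Contraction\<close>

lemma smaller_solvedD1:
  fixes W W' :: "'v set"
  shows "smaller_solved k W m \<Longrightarrow> admissible k W' m' P R t X S \<Longrightarrow> card W' < card W \<Longrightarrow> solvable k W' m' P R t S"
  unfolding smaller_solved_def by blast

lemma smaller_solvedD2:
  "smaller_solved k W m \<Longrightarrow> admissible k W m' P R t X S \<Longrightarrow> cut_weight m' W W < cut_weight m W W \<Longrightarrow> solvable k W m' P R t S"
  unfolding smaller_solved_def by blast

text \<open>Greedy filling up to the capacities \<open>b\<close>.\<close>

lemma distribute_sum: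
  fixes b :: "'v \<Rightarrow> int"
  assumes "finite A" "\<And>x. x \<in> A \<Longrightarrow> 0 \<le> b x" "0 \<le> s" "s \<le> sum b A"
  shows "\<exists>g. (\<forall>x\<in>A. 0 \<le> g x \<and> g x \<le> b x) \<and> sum g A = s"
  using assms
proof (induction A arbitrary: s rule: finite_induct)
  case empty
  then show ?case by simp
next
  case (insert a A)
  define c where "c = min s (b a)"
  have "0 \<le> s - c" "s - c \<le> sum b A"
    using insert by (auto simp: c_def min_def sum_nonneg)
  then obtain g where g: "\<forall>x\<in>A. 0 \<le> g x \<and> g x \<le> b x" "sum g A = s - c"
    using insert.IH[of "s - c"] insert.prems by auto
  have "sum (g(a := c)) A = sum g A"
    using insert.hyps by (intro sum.cong) auto
  then show ?case
    using g insert by (intro exI[of _ "g(a := c)"]) (auto simp: c_def)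
qed

text \<open>
  Solves the graph in which \<open>A\<close> is contracted to \<open>a\<close>, and distributes the edges at \<open>a\<close> over \<open>A\<close>.
\<close>

lemma contract_side:
  fixes k :: int
  assumes k: "0 < k" and I: "admissible k W m P R t X S" and H: "smaller_solved k W m"
    and A: "A \<subset> W" "a \<in> A" "a' \<in> A" "a \<noteq> a'"
  obtains f g where
    "orients (insert a (W - A)) (\<lambda>u v. if u = v then 0 else cut_weight m (if u = a then A else {u}) (if v = a then A else {v})) f"
    "\<And>v. v \<in> W - A \<Longrightarrow> 2 * k dvd net_outdegree (insert a (W - A)) f v - P v + R v - t v"
    "2 * k dvd net_outdegree (insert a (W - A)) f a - sum P A + sum R A - sum t A"
    "\<And>v. v \<in> S - A \<Longrightarrow> \<bar>net_outdegree (insert a (W - A)) f v - P v + R v\<bar> \<le> boundary_degree W m P R {v} - 2"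
    "\<And>x b. x \<in> A \<Longrightarrow> b \<in> W - A \<Longrightarrow> 0 \<le> g x b \<and> g x b \<le> m x b"
    "\<And>b. b \<in> W - A \<Longrightarrow> (\<Sum>x\<in>A. g x b) = f a b"
    "\<And>b. b \<in> W - A \<Longrightarrow> (\<Sum>x\<in>A. m x b - g x b) = f b a"
proof -
  note D = admissibleD[OF I]
  have fA: "finite A" using A(1) D(1) by (meson finite_subset psubset_imp_subset)
  \<comment> \<open>\<open>q u\<close> is the preimage of \<open>u\<close> under the contraction,
    and \<open>E\<close> below is the preimage of a set. Boundary degrees and demands of a set are
    those of its preimage.\<close>
  define q where "q u = (if u = a then A else {u})" for u
  define m1 where "m1 u v = (if u = v then 0 else cut_weight m (q u) (q v))" for u v
  define W1 where "W1 = insert a (W - A)"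
  define P1 where "P1 u = sum P (q u)" for u
  define R1 where "R1 u = sum R (q u)" for u
  define t1 where "t1 u = sum t (q u)" for u
  define E where "E A1 = (\<Union>u\<in>A1. q u)" for A1
  have fW1: "finite W1" using D(1) by (simp add: W1_def)
  have fq: "finite (q u)" for u using fA by (simp add: q_def)
  have dq: "q u \<inter> q v = {}" if "u \<in> W1" "v \<in> W1" "u \<noteq> v" for u v
    using that by (auto simp: q_def W1_def)
  have sumE: "sum h (E A1) = (\<Sum>u\<in>A1. sum h (q u))" if "A1 \<subseteq> W1" for h :: "'a \<Rightarrow> int" and A1
    unfolding E_def
  proof (rule sum.UNION_disjoint)
    show "finite A1" using that fW1 by (rule finite_subset)
    show "\<forall>u\<in>A1. \<forall>v\<in>A1. u \<noteq> v \<longrightarrow> q u \<inter> q v = {}" using that dq by blast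
  qed (use fq in blast)
  have EW: "E W1 = W" using A by (auto simp: E_def W1_def q_def)
  have Ediff: "E (W1 - A1) = W - E A1" if "A1 \<subseteq> W1" for A1
    using that A(1,2) by (auto simp: E_def W1_def q_def split: if_splits)
  have cutE: "cut_weight m (E A1) (E B1) = cut_weight m1 A1 B1" if "A1 \<subseteq> W1" "B1 \<subseteq> W1" "A1 \<inter> B1 = {}" for A1 B1
  proof -
    have "cut_weight m (E A1) (E B1) = (\<Sum>u\<in>A1. \<Sum>x\<in>q u. \<Sum>v\<in>B1. \<Sum>y\<in>q v. m x y)"
      unfolding cut_weight_def using that by (simp add: sumE)
    also have "\<dots> = (\<Sum>u\<in>A1. \<Sum>v\<in>B1. \<Sum>x\<in>q u. \<Sum>y\<in>q v. m x y)"
      by (subst sum.swap) simp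
    also have "\<dots> = cut_weight m1 A1 B1"
      unfolding cut_weight_def m1_def using that by (intro sum.cong refl) auto
    finally show ?thesis .
  qed
  have bE: "boundary_degree W1 m1 P1 R1 A1 = boundary_degree W m P R (E A1)" if "A1 \<subseteq> W1" for A1
    unfolding boundary_degree_def P1_def R1_def using that cutE[OF that, of "W1 - A1"]
    by (simp add: sumE Ediff Int_commute Diff_disjoint)
  have fE: "feasible k W1 m1 P1 R1 t1 j A1 = feasible k W m P R t j (E A1)" if "A1 \<subseteq> W1" for A1 j
    unfolding feasible_def bE[OF that] t1_def sumE[OF that, symmetric] ..
  have E1: "E {v} = q v" for v by (simp add: E_def)
  have qn: "q v \<noteq> {}" for v using A(2) by (auto simp: q_def)
  \<comment> \<open>The preimage of \<open>a\<close> contains both \<open>a\<close> and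
    \<open>a'\<close>, so it is never the exempt singleton, and its feasibility is available even if
    the exempt vertex lies in \<open>A\<close>.\<close>
  have qX: "q v \<noteq> {u}" if "v = a" for u v using that A by (auto simp: q_def)
  have qW: "q v \<subseteq> W" if "v \<in> W1" for v using that A(1) by (auto simp: q_def W1_def)
  have I1: "admissible k W1 m1 P1 R1 t1 (X - A) (S - A)"
  proof (rule admissibleI)
    show "finite W1" by fact
    show "W1 \<noteq> {}" by (simp add: W1_def)
    show "m1 u v = m1 v u" for u v
      using cut_weight_sym[of m "q u" "q v"] D(3) by (simp add: m1_def)
    show "0 \<le> m1 u v" for u v
      using cut_weight_nonneg[of m "q u" "q v"] D(4) by (simp add: m1_def)
    show "m1 v v = 0" for v by (simp add: m1_def)
    show "0 \<le> P1 v" "0 \<le> R1 v" if "v \<in> W1" for v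
      unfolding P1_def R1_def using qW[OF that] D(6,7) by (auto intro!: sum_nonneg)
    show "even (t1 v - boundary_degree W1 m1 P1 R1 {v})" if "v \<in> W1" for v
      using parity_set[OF I qW[OF that]] that by (simp add: bE E1 t1_def)
    have s: "sum t1 W1 = sum t W" "sum P1 W1 = sum P W" "sum R1 W1 = sum R W"
      unfolding t1_def P1_def R1_def by (simp_all add: sumE[symmetric] EW)
    show "2 * k dvd sum t1 W1 + sum P1 W1 - sum R1 W1" "in_bounds k (sum P1 W1) (sum R1 W1)"
      using D(9,10) by (simp_all add: s)
    show "feasible k W1 m1 P1 R1 t1 (2 * k - 2) A1"
      if "A1 \<noteq> {}" "A1 \<subset> W1" "\<And>v. v \<in> X - A \<Longrightarrow> A1 \<noteq> {v}" for A1
    proof -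
      have s1: "A1 \<subseteq> W1" using that by auto
      have "E A1 \<noteq> {}" using that qn by (auto simp: E_def)
      moreover have "E A1 \<subseteq> W" using s1 qW by (auto simp: E_def)
      moreover have "E A1 \<noteq> W"
      proof
        assume "E A1 = W"
        then have "E (W1 - A1) = {}" using Ediff[OF s1] by simp
        then have "W1 - A1 = {}" using qn by (auto simp: E_def)
        then show False using that by auto
      qed
      moreover have "E A1 \<noteq> {v}" if "v \<in> X" for v
      proof
        assume e: "E A1 = {v}"
        obtain u where u: "u \<in> A1" using \<open>A1 \<noteq> {}\<close> by auto
        have sub: "q u' = {v}" if "u' \<in> A1" for u'
          using e qn[of u'] that by (auto simp: E_def)
        have "u' \<noteq> a \<and> u' = v" if "u' \<in> A1" for u'
          using sub[OF that] qX[of u' v] by (auto simp: q_def split: if_splits)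
        then have "A1 = {v}" "v \<noteq> a" using u by auto
        then have "v \<notin> A" using s1 by (auto simp: W1_def)
        then show False using \<open>A1 = {v}\<close> \<open>v \<in> X\<close> \<open>\<And>v. v \<in> X - A \<Longrightarrow> A1 \<noteq> {v}\<close> by auto
      qed
      ultimately have "feasible k W m P R t (2 * k - 2) (E A1)" by (intro D(11)) auto
      then show ?thesis by (simp add: fE[OF s1])
    qed
    show "S - A \<subseteq> W1" using D(16) by (auto simp: W1_def)
    show "feasible k W1 m1 P1 R1 t1 (2 * k) {v}" if "v \<in> S - A" for v
    proof -
      have "v \<in> W1" "q v = {v}" using that D(16) A(2) by (auto simp: W1_def q_def)
      then show ?thesis using D(17)[of v] that by (simp add: fE E1)
    qed
    show "X - A = {v} \<and> v \<in> W1 \<and> S - A = {} \<and> 2 * k dvd t1 v" if "v \<in> X - A" for v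
      using that D(12,13,14,15)[of v] A(2) by (auto simp: W1_def t1_def q_def)
  qed
  have "card W1 = Suc (card (W - A))" using D(1) A(2) by (simp add: W1_def)
  moreover have "card {a, a'} \<le> card A" using fA A by (intro card_mono) auto
  moreover have "card (W - A) = card W - card A" "card A \<le> card W"
    using fA A(1) D(1) by (auto intro: card_Diff_subset card_mono)
  ultimately have "card W1 < card W" using A(4) by auto
  then have "solvable k W1 m1 P1 R1 t1 (S - A)"
    using smaller_solvedD1[OF H I1] by simp
  then obtain f where f: "orients W1 m1 f"
    "\<And>v. v \<in> W1 \<Longrightarrow> 2 * k dvd net_outdegree W1 f v - P1 v + R1 v - t1 v"
    "\<And>v. v \<in> S - A \<Longrightarrow> \<bar>net_outdegree W1 f v - P1 v + R1 v\<bar> \<le> boundary_degree W1 m1 P1 R1 {v} - 2"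
    by (auto simp: solvable_def)
  have q1: "q v = {v}" "v \<in> W1" if "v \<in> W - A" for v using that A(2) by (auto simp: q_def W1_def)
  have fa: "0 \<le> f a b" "f a b + f b a = (\<Sum>x\<in>A. m x b)" "0 \<le> f b a" if b: "b \<in> W - A" for b
  proof -
    have "a \<noteq> b" using A(2) b by auto
    then have "m1 a b = (\<Sum>x\<in>A. m x b)"
      using q1[OF b] by (simp add: m1_def cut_weight_def q_def)
    then show "0 \<le> f a b" "f a b + f b a = (\<Sum>x\<in>A. m x b)" "0 \<le> f b a"
      using f(1) q1[OF b] by (auto simp: orients_def W1_def)
  qed
  \<comment> \<open>Of the edges between \<open>A\<close> and \<open>b\<close>, \<open>f a b\<close>
    have to leave \<open>A\<close>. Which ends in \<open>A\<close> they use is immaterial.\<close>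
  have "\<exists>g. (\<forall>x\<in>A. 0 \<le> g x \<and> g x \<le> m x b) \<and> sum g A = f a b" if b: "b \<in> W - A" for b
    using fa[OF b] fA D(4) by (intro distribute_sum) auto
  then obtain g where g: "\<And>b. b \<in> W - A \<Longrightarrow> (\<forall>x\<in>A. 0 \<le> g b x \<and> g b x \<le> m x b) \<and> sum (g b) A = f a b"
    by metis
  show thesis
  proof (rule that[of f "\<lambda>x b. g b x"])
    show "orients (insert a (W - A)) (\<lambda>u v. if u = v then 0 else cut_weight m (if u = a then A else {u}) (if v = a then A else {v})) f"
      using f(1) unfolding m1_def[abs_def] q_def W1_def .
    show "2 * k dvd net_outdegree (insert a (W - A)) f v - P v + R v - t v" if "v \<in> W - A" for v
      using f(2)[OF q1(2)[OF that]] q1[OF that] by (simp add: W1_def P1_def R1_def t1_def)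
    show "2 * k dvd net_outdegree (insert a (W - A)) f a - sum P A + sum R A - sum t A"
      using f(2)[of a] by (simp add: W1_def P1_def R1_def t1_def q_def)
    show "\<bar>net_outdegree (insert a (W - A)) f v - P v + R v\<bar> \<le> boundary_degree W m P R {v} - 2" if "v \<in> S - A" for v
    proof -
      have v: "v \<in> W - A" using that D(16) by auto
      show ?thesis using f(3)[OF that] q1[OF v] bE[of "{v}"]
        by (simp add: P1_def R1_def E1 flip: W1_def)
    qed
    show "0 \<le> g b x \<and> g b x \<le> m x b" if "x \<in> A" "b \<in> W - A" for x b
      using g[OF that(2)] that(1) by auto
    show "(\<Sum>x\<in>A. g b x) = f a b" if "b \<in> W - A" for b using g[OF that] by auto
    show "(\<Sum>x\<in>A. m x b - g b x) = f b a" if "b \<in> W - A" for b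
      using g[OF that] fa[OF that] by (simp add: sum_subtractf)
  qed
qed

text \<open>The graph with \<open>A\<close> contracted is oriented first. Then \<open>W - A\<close>
  and \<open>z\<close> together act as the special vertex for \<open>A\<close>. The missing slack of
  \<open>A\<close> is just what bounds the numbers of arcs prescribed there.\<close>

lemma contract:
  fixes k :: int
  assumes k: "0 < k" and I: "admissible k W m P R t X S" and H: "smaller_solved k W m"
    and A: "A \<subset> W" "2 \<le> card A" and ns: "\<not> feasible k W m P R t (2 * k) A"
  shows "solvable k W m P R t S"
proof -
  note D = admissibleD[OF I]
  define B where "B = W - A"
  have fA: "finite A" "finite B" and AB: "A \<inter> B = {}" "W = A \<union> B" "B \<noteq> {}"
    using A(1) D(1) by (auto simp: B_def dest: finite_subset)
  obtain a a' where a: "a \<in> A" "a' \<in> A" "a \<noteq> a'"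
    using A(2) by (metis card_le_Suc0_iff_eq fA(1) not_less_eq_eq numeral_2_eq_2)
  obtain f g where gf:
    "orients (insert a (W - A)) (\<lambda>u v. if u = v then 0 else cut_weight m (if u = a then A else {u}) (if v = a then A else {v})) f"
    "\<And>v. v \<in> W - A \<Longrightarrow> 2 * k dvd net_outdegree (insert a (W - A)) f v - P v + R v - t v"
    "2 * k dvd net_outdegree (insert a (W - A)) f a - sum P A + sum R A - sum t A"
    "\<And>v. v \<in> S - A \<Longrightarrow> \<bar>net_outdegree (insert a (W - A)) f v - P v + R v\<bar> \<le> boundary_degree W m P R {v} - 2"
    "\<And>x b. x \<in> A \<Longrightarrow> b \<in> W - A \<Longrightarrow> 0 \<le> g x b \<and> g x b \<le> m x b"
    "\<And>b. b \<in> W - A \<Longrightarrow> (\<Sum>x\<in>A. g x b) = f a b"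
    "\<And>b. b \<in> W - A \<Longrightarrow> (\<Sum>x\<in>A. m x b - g x b) = f b a"
    by (rule contract_side[OF k I H A(1) a], rule that) blast+
  note gf = gf[folded B_def]
  have aB: "a \<notin> B" using a AB by auto
  \<comment> \<open>Arcs fixed between \<open>A\<close> and \<open>B\<close> become prescribed
    edges: those entering \<open>A\<close> join \<open>P\<close>, those leaving \<open>A\<close>
    join \<open>R\<close>.\<close>
  define P2 where "P2 y = P y + (\<Sum>b\<in>B. m y b - g y b)" for y
  define R2 where "R2 y = R y + (\<Sum>b\<in>B. g y b)" for y
  have b2: "boundary_degree A m P2 R2 A' = boundary_degree W m P R A'" if "A' \<subseteq> A" for A'
  proof -
    have "W - A' = (A - A') \<union> B" using that AB by auto
    then have "cut_weight m A' (W - A') = cut_weight m A' (A - A') + cut_weight m A' B"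
      using fA AB that by (simp add: cut_weight_Un_right Diff_Int_distrib2)
    then show ?thesis
      by (simp add: boundary_degree_def P2_def R2_def sum.distrib cut_weight_def sum_subtractf)
  qed
  have f2: "feasible k A m P2 R2 t j A' = feasible k W m P R t j A'" if "A' \<subseteq> A" for j A'
    using b2[OF that] by (simp add: feasible_def)
  have sR: "sum R2 A = sum R A + (\<Sum>b\<in>B. f a b)"
    unfolding R2_def by (simp add: sum.distrib sum.swap[of g] gf(6))
  have sP: "sum P2 A = sum P A + (\<Sum>b\<in>B. f b a)"
    unfolding P2_def by (simp add: sum.distrib sum.swap[of "\<lambda>x b. m x b - g x b"] gf(7))
  have na: "net_outdegree (insert a B) f a = (\<Sum>b\<in>B. f a b) - (\<Sum>b\<in>B. f b a)"
    using fA aB by (simp add: net_outdegree_def sum_subtractf)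
  have nnP: "0 \<le> P2 y" "0 \<le> R2 y" if "y \<in> A" for y
    using that gf(5)[OF that] D(6,7)[of y] AB
    by (auto simp: P2_def R2_def intro!: add_nonneg_nonneg sum_nonneg)
  have nn: "0 \<le> sum P2 A" "0 \<le> sum R2 A" using nnP by (auto intro: sum_nonneg)
  have dv: "2 * k dvd (sum R2 A - sum P2 A) - sum t A"
    using gf(3) by (simp add: na sR sP algebra_simps)
  have tot: "sum P2 A + sum R2 A = boundary_degree W m P R A"
    using b2[of A] by (simp add: boundary_degree_def cut_weight_def)
  have not_fit: "\<not> \<bar>T\<bar> \<le> sum P2 A + sum R2 A - 2 * k" if "2 * k dvd T - sum t A" for T
    using ns that by (auto simp: feasible_def tot)
  have shift: "2 * k dvd (sum R2 A - sum P2 A + c * (2 * k)) - sum t A" for c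
    using dv by (metis add_diff_eq add.commute dvd_add dvd_triv_right)
  \<comment> \<open>With p and r the two sums, none of the candidates r - p and r - p \<plusminus>
    2k has slack \<open>2 * k\<close>. The first gives p < k or r < k, the other two give p < 2k and
    r < 2k.\<close>
  have inb2: "in_bounds k (sum P2 A) (sum R2 A)"
    using not_fit[OF shift[of 0]] not_fit[OF shift[of 1]] not_fit[OF shift[of "-1"]] nn
    unfolding in_bounds_def by (simp add: abs_le_iff) linarith
  have I2: "admissible k A m P2 R2 t (X \<inter> A) (S \<inter> A)"
  proof (rule admissibleI)
    show "A \<noteq> {}" using a by auto
    show "even (t v - boundary_degree A m P2 R2 {v})" if "v \<in> A" for v
      using D(8)[of v] that AB by (simp add: b2)
    show "2 * k dvd sum t A + sum P2 A - sum R2 A"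
      using dv dvd_minus_iff[of "2 * k" "sum R2 A - sum P2 A - sum t A"] by (simp add: algebra_simps)
    show "feasible k A m P2 R2 t (2 * k - 2) A'"
      if "A' \<noteq> {}" "A' \<subset> A" "\<And>v. v \<in> X \<inter> A \<Longrightarrow> A' \<noteq> {v}" for A'
    proof -
      have "feasible k W m P R t (2 * k - 2) A'"
        using that A(1) by (intro D(11)) auto
      then show ?thesis using that by (simp add: f2)
    qed
    show "feasible k A m P2 R2 t (2 * k) {v}" if "v \<in> S \<inter> A" for v
      using D(17)[of v] that by (simp add: f2)
    show "X \<inter> A = {v} \<and> v \<in> A \<and> S \<inter> A = {} \<and> 2 * k dvd t v" if "v \<in> X \<inter> A" for v
      using D(12,14,15)[of v] that by auto
  qed (use fA D nnP inb2 in auto)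
  have "card A < card W" using A(1) D(1) by (rule psubset_card_mono[rotated])
  then have "solvable k A m P2 R2 t (S \<inter> A)"
    using smaller_solvedD1[OF H I2] by simp
  then obtain h where h: "orients A m h"
    "\<And>v. v \<in> A \<Longrightarrow> 2 * k dvd net_outdegree A h v - P2 v + R2 v - t v"
    "\<And>v. v \<in> S \<inter> A \<Longrightarrow> \<bar>net_outdegree A h v - P2 v + R2 v\<bar> \<le> boundary_degree A m P2 R2 {v} - 2"
    by (auto simp: solvable_def)
  define F where "F u v = (if u \<in> A then (if v \<in> A then h u v else g u v)
      else (if v \<in> A then m v u - g v u else f u v))" for u v
  have F: "F u v = h u v" "F u b = g u b" "F b u = m u b - g u b" "F b c = f b c"
    if "u \<in> A" "v \<in> A" "b \<in> B" "c \<in> B" for u v b c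
    using that AB by (auto simp: F_def)
  have oF: "orients W m F"
    unfolding orients_def
  proof (intro ballI)
    fix u v assume "u \<in> W" "v \<in> W"
    then consider "u \<in> A" "v \<in> A" | "u \<in> A" "v \<in> B" | "u \<in> B" "v \<in> A" | "u \<in> B" "v \<in> B"
      using AB by auto
    then show "0 \<le> F u v \<and> F u v + F v u = m u v"
    proof cases
      case 1
      then show ?thesis using h(1) a AB by (auto simp: F_def orients_def)
    next
      case 2
      then have "v \<notin> A" using AB by auto
      then show ?thesis using gf(5)[OF 2] 2 by (auto simp: F_def)
    next
      case 3
      then have "u \<notin> A" using AB by auto
      then show ?thesis using gf(5)[OF 3(2,1)] 3 D(3)[of u v] by (auto simp: F_def)
    next
      case 4
      then have "u \<notin> A" "v \<notin> A" using AB by auto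
      moreover have "u \<noteq> a" "v \<noteq> a" using 4 aB by auto
      ultimately show ?thesis
        using gf(1) 4 D(5) by (auto simp: F_def orients_def cut_weight_def)
    qed
  qed
  have nA: "net_outdegree W F y - P y + R y = net_outdegree A h y - P2 y + R2 y" if "y \<in> A" for y
  proof -
    have "net_outdegree W F y = (\<Sum>u\<in>A. F y u - F u y) + (\<Sum>u\<in>B. F y u - F u y)"
      unfolding net_outdegree_def AB(2) using fA AB(1) by (intro sum.union_disjoint)
    also have "(\<Sum>u\<in>A. F y u - F u y) = net_outdegree A h y"
      unfolding net_outdegree_def using that by (intro sum.cong) (auto simp: F_def)
    also have "(\<Sum>u\<in>B. F y u - F u y) = (\<Sum>u\<in>B. g y u - (m y u - g y u))"
      using that AB by (intro sum.cong) (auto simp: F_def)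
    finally show ?thesis by (simp add: P2_def R2_def sum_subtractf flip: sum_distrib_left)
  qed
  have nB: "net_outdegree W F b = net_outdegree (insert a B) f b" if "b \<in> B" for b
  proof -
    have "net_outdegree W F b = (\<Sum>u\<in>A. F b u - F u b) + (\<Sum>u\<in>B. F b u - F u b)"
      unfolding net_outdegree_def AB(2) using fA AB(1) by (intro sum.union_disjoint)
    also have "(\<Sum>u\<in>A. F b u - F u b) = (\<Sum>u\<in>A. (m u b - g u b) - g u b)"
      using that AB by (intro sum.cong) (auto simp: F_def)
    also have "\<dots> = f b a - f a b"
      using gf(6,7)[OF that] by (simp add: sum_subtractf flip: sum_distrib_left)
    also have "(\<Sum>u\<in>B. F b u - F u b) = (\<Sum>u\<in>B. f b u - f u b)"
      using that AB by (intro sum.cong) (auto simp: F_def)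
    finally show ?thesis using fA aB by (simp add: net_outdegree_def)
  qed
  show ?thesis
    unfolding solvable_def
  proof (intro exI[of _ F] conjI ballI oF)
    show "2 * k dvd net_outdegree W F v - P v + R v - t v" if "v \<in> W" for v
      using h(2)[of v] gf(2)[of v] nA[of v] nB[of v] that AB by (cases "v \<in> A") auto
    show "\<bar>net_outdegree W F v - P v + R v\<bar> \<le> boundary_degree W m P R {v} - 2" if "v \<in> S" for v
    proof (cases "v \<in> A")
      case True
      then show ?thesis using h(3)[of v] nA[of v] b2[of "{v}"] that by simp
    next
      case False
      then have "v \<in> B" using that D(16) AB by auto
      then show ?thesis using gf(4)[of v] nB[of v] that False by simp
    qed
  qed
qed

section \<open>Lifting\<close>

text \<open>The situation that remains when \<open>contract\<close> does not apply. Singletons are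
  left out because contracting one makes nothing smaller; their slack is treated vertex by
  vertex.\<close>

definition big_slack :: "int \<Rightarrow> 'v set \<Rightarrow> ('v \<Rightarrow> 'v \<Rightarrow> int) \<Rightarrow> ('v \<Rightarrow> int) \<Rightarrow> ('v \<Rightarrow> int) \<Rightarrow> ('v \<Rightarrow> int) \<Rightarrow> bool" where
  "big_slack k W m P R t \<longleftrightarrow> (\<forall>A. A \<subset> W \<longrightarrow> 2 \<le> card A \<longrightarrow> feasible k W m P R t (2 * k) A)"

lemma feasible_lower:
  assumes "feasible k W m P R t j A" "boundary_degree W m P R A - j \<le> boundary_degree W m' P' R' A - j'"
  shows "feasible k W m' P' R' t j' A"
  using assms unfolding feasible_def by (meson order_trans)

text \<open>The common check for all liftings. Demands and totals at \<open>z\<close> stay the same,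
  so a set may lose two boundary edges if it had slack \<open>2 * k\<close>, and a mark survives
  where the boundary degree does not drop.\<close>

lemma admissible_lower:
  assumes I: "admissible k W m P R t X S"
    and m': "\<And>u v. m' u v = m' v u" "\<And>u v. 0 \<le> m' u v" "\<And>v. m' v v = 0"
    and PR: "\<And>v. v \<in> W \<Longrightarrow> 0 \<le> P' v" "\<And>v. v \<in> W \<Longrightarrow> 0 \<le> R' v"
      "sum P' W = sum P W" "sum R' W = sum R W"
    and par: "\<And>v. v \<in> W \<Longrightarrow> even (boundary_degree W m P R {v} - boundary_degree W m' P' R' {v})"
    and low: "\<And>A. A \<noteq> {} \<Longrightarrow> A \<subset> W \<Longrightarrow> (\<And>v. v \<in> X \<Longrightarrow> A \<noteq> {v}) \<Longrightarrow>
      boundary_degree W m P R A \<le> boundary_degree W m' P' R' A \<or> feasible k W m P R t (2 * k) A \<and> boundary_degree W m P R A - 2 \<le> boundary_degree W m' P' R' A"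
    and S': "S' \<subseteq> S" "\<And>u. u \<in> S' \<Longrightarrow> boundary_degree W m P R {u} \<le> boundary_degree W m' P' R' {u}"
  shows "admissible k W m' P' R' t X S'"
proof (rule admissibleI)
  note D = admissibleD[OF I]
  show "even (t v - boundary_degree W m' P' R' {v})" if "v \<in> W" for v
    using D(8)[OF that] par[OF that] by simp
  show "feasible k W m' P' R' t (2 * k - 2) A"
    if "A \<noteq> {}" "A \<subset> W" "\<And>v. v \<in> X \<Longrightarrow> A \<noteq> {v}" for A
    using low[OF that]
  proof
    assume "boundary_degree W m P R A \<le> boundary_degree W m' P' R' A"
    then show ?thesis using D(11)[OF that] feasible_lower by fastforce
  next
    assume "feasible k W m P R t (2 * k) A \<and> boundary_degree W m P R A - 2 \<le> boundary_degree W m' P' R' A"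
    then show ?thesis using feasible_lower[of k W m P R t "2 * k" A m' P' R' "2 * k - 2"] by simp
  qed
  show "feasible k W m' P' R' t (2 * k) {v}" if "v \<in> S'" for v
    using D(17)[of v] S' that feasible_lower[of k W m P R t "2 * k" "{v}" m' P' R' "2 * k"] by auto
  show "X = {v} \<and> v \<in> W \<and> S' = {} \<and> 2 * k dvd t v" if "v \<in> X" for v
    using D(12,13,14,15)[OF that] S' by auto
  show "S' \<subseteq> W" using S' D(16) by auto
qed (use admissibleD[OF I] m' PR in simp_all)

lemma card_ge_2I: "finite W \<Longrightarrow> A \<subset> W \<Longrightarrow> A \<noteq> {} \<Longrightarrow> (\<And>v. A \<noteq> {v}) \<Longrightarrow> 2 \<le> card A"
  by (metis One_nat_def card_1_singletonE card_eq_0_iff finite_subset less_2_cases linorder_not_le psubset_imp_subset)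

lemma big_slackD:
  assumes "big_slack k W m P R t" "finite W" "A \<noteq> {}" "A \<subset> W" "\<And>v. A = {v} \<Longrightarrow> feasible k W m P R t (2 * k) {v}"
  shows "feasible k W m P R t (2 * k) A"
  using assms card_ge_2I[OF assms(2,4,3)] unfolding big_slack_def by metis

lemma edge_unit_sym: "edge_unit x y u v = edge_unit x y v u"
  by (simp add: edge_unit_def conj_commute)

lemma edge_unit_diag: "x \<noteq> y \<Longrightarrow> edge_unit x y v v = 0"
  by (auto simp: edge_unit_def)

lemma orients_add_arc:
  assumes "orients W (\<lambda>u w. m u w + (-1) * edge_unit v x u w) f"
  shows "orients W m (\<lambda>u w. f u w + 1 * of_bool (u = v \<and> w = x))"
  unfolding orients_def
proof (intro ballI)
  fix u w assume "u \<in> W" "w \<in> W"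
  then have "0 \<le> f u w" "f u w + f w u = m u w - edge_unit v x u w"
    using assms by (auto simp: orients_def)
  then show "0 \<le> f u w + 1 * of_bool (u = v \<and> w = x) \<and>
      f u w + 1 * of_bool (u = v \<and> w = x) + (f w u + 1 * of_bool (w = v \<and> u = x)) = m u w"
    by (simp add: edge_unit_def conj_commute)
qed

text \<open>
  Lifts a path \<open>z, v, x\<close> to an edge from \<open>z\<close> to \<open>x\<close>.
\<close>

lemma lift_prescribed:
  assumes I: "admissible k W m P R t X S" and H: "smaller_solved k W m" and B: "big_slack k W m P R t"
    and v: "v \<in> W" "v \<in> X \<or> feasible k W m P R t (2 * k) {v}" "0 < P v"
    and x: "x \<in> W" "x \<noteq> v" "0 < m v x"
  shows "solvable k W m P R t S"
proof -
  note D = admissibleD[OF I]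
  define m' where "m' u w = m u w + (-1) * edge_unit v x u w" for u w
  define P' where "P' u = P u + (-1) * of_bool (u = v) + 1 * of_bool (u = x)" for u
  have b: "boundary_degree W m' P' R A = boundary_degree W m P R A - 2 * of_bool (v \<in> A \<and> x \<notin> A)" if "A \<subseteq> W" for A
  proof -
    have "finite A" using that D(1) by (rule finite_subset)
    then have "boundary_degree W m' P' R A = boundary_degree W m P R A + 1 * of_bool (x \<in> A) + (-1) * of_bool (v \<in> A)
        + (-1) * of_bool ((v \<in> A) \<noteq> (x \<in> A))"
      using that D(1) v x
      by (simp only: m'_def[abs_def] P'_def[abs_def] boundary_degree_add_edge_unit boundary_degree_add_P)
    then show ?thesis by auto
  qed
  have I': "admissible k W m' P' R t X (S - {v})"
  proof (rule admissible_lower[OF I])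
    show "m' u w = m' w u" "m' w w = 0" for u w
      using D(3)[of u w] D(5) x edge_unit_sym[of v x u w] edge_unit_diag[of v x] by (simp_all add: m'_def)
    show "0 \<le> m' u w" for u w
      using D(4)[of u w] x D(3)[of x v] by (auto simp: m'_def edge_unit_def)
    show "0 \<le> P' w" if "w \<in> W" for w
      using D(6)[OF that] v(3) by (auto simp: P'_def)
    show "sum P' W = sum P W"
      unfolding P'_def[abs_def] sum_point[OF D(1)] using v x by simp
    show "boundary_degree W m P R A \<le> boundary_degree W m' P' R A \<or>
        feasible k W m P R t (2 * k) A \<and> boundary_degree W m P R A - 2 \<le> boundary_degree W m' P' R A"
      if A: "A \<noteq> {}" "A \<subset> W" "\<And>v. v \<in> X \<Longrightarrow> A \<noteq> {v}" for A
    proof (cases "v \<in> A \<and> x \<notin> A")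
      case True
      have "feasible k W m P R t (2 * k) A"
      proof (rule big_slackD[OF B D(1) A(1,2)])
        fix u assume "A = {u}"
        then have "A = {v}" "u = v" using True by auto
        then show "feasible k W m P R t (2 * k) {u}" using v(2) A(3) by auto
      qed
      then show ?thesis using b A(2) by auto
    next
      case False
      then show ?thesis using b[of A] A(2) by auto
    qed
  qed (use D b in auto)
  have "cut_weight m' W W < cut_weight m W W"
    unfolding m'_def[abs_def] cut_weight_add cut_weight_scale cut_weight_edge_unit[OF D(1) D(1)] using v x by simp
  then have "solvable k W m' P' R t (S - {v})"
    using smaller_solvedD2[OF H I'] by simp
  then obtain f' where f': "orients W m' f'"
    "\<And>w. w \<in> W \<Longrightarrow> 2 * k dvd net_outdegree W f' w - P' w + R w - t w"
    "\<And>w. w \<in> S - {v} \<Longrightarrow> \<bar>net_outdegree W f' w - P' w + R w\<bar> \<le> boundary_degree W m' P' R {w} - 2"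
    by (auto simp: solvable_def)
  define f where "f u w = f' u w + 1 * of_bool (u = v \<and> w = x)" for u w
  have n: "net_outdegree W f w - P w = net_outdegree W f' w - P' w" for w
    unfolding f_def[abs_def] net_outdegree_add[OF D(1)] P'_def using v x by simp
  have "orients W m f"
    using f'(1) unfolding m'_def f_def by (rule orients_add_arc)
  moreover have "\<bar>net_outdegree W f w - P w + R w\<bar> \<le> boundary_degree W m P R {w} - 2" if "w \<in> S" for w
  proof (cases "w = v")
    case True
    have "\<bar>net_outdegree W f' v - P' v + R v\<bar> \<le> boundary_degree W m' P' R {v}"
      using admissibleD[OF I'] v f'(1) by (intro net_outdegree_bound) auto
    then show ?thesis using b[of "{v}"] v x True n by auto
  next
    case False
    then show ?thesis using f'(3)[of w] that b[of "{w}"] D(16) n[of w] by auto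
  qed
  ultimately show ?thesis
    using f'(2) n unfolding solvable_def by metis
qed

lemma lift_prescribed':
  assumes I: "admissible k W m P R t X S" and H: "smaller_solved k W m" and B: "big_slack k W m P R t"
    and v: "v \<in> W" "v \<in> X \<or> feasible k W m P R t (2 * k) {v}" "0 < R v"
    and x: "x \<in> W" "x \<noteq> v" "0 < m v x"
  shows "solvable k W m P R t S"
proof (rule solvable_swap, rule lift_prescribed[OF admissible_swap[OF I] H])
  show "big_slack k W m R P (\<lambda>v. - t v)"
    using B by (auto simp: big_slack_def intro: feasible_swap)
  show "v \<in> X \<or> feasible k W m R P (\<lambda>v. - t v) (2 * k) {v}"
    using v(2) feasible_swap by blast
qed (use v x in auto)

text \<open>The edges vx and vy are replaced by one edge xy. Afterwards some arc between x and y is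
  subdivided by v, which changes no net outdegree.\<close>

lemma lift_pair:
  assumes I: "admissible k W m P R t X S" and H: "smaller_solved k W m" and B: "big_slack k W m P R t"
    and v: "v \<in> W" "v \<in> X \<or> feasible k W m P R t (2 * k) {v}"
    and x: "x \<in> W" "x \<noteq> v" "0 < m v x" and y: "y \<in> W" "y \<noteq> v" "0 < m v y" "x \<noteq> y"
  shows "solvable k W m P R t S"
proof -
  note D = admissibleD[OF I]
  define m' where "m' u w = m u w + (-1) * edge_unit v x u w + (-1) * edge_unit v y u w + 1 * edge_unit x y u w" for u w
  have b: "boundary_degree W m' P R A = boundary_degree W m P R A - 2 * of_bool ((v \<in> A) \<noteq> (x \<in> A) \<and> (v \<in> A) \<noteq> (y \<in> A))"
    if "A \<subseteq> W" for A
  proof -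
    have "boundary_degree W m' P R A = boundary_degree W m P R A + (-1) * of_bool ((v \<in> A) \<noteq> (x \<in> A))
        + (-1) * of_bool ((v \<in> A) \<noteq> (y \<in> A)) + 1 * of_bool ((x \<in> A) \<noteq> (y \<in> A))"
      unfolding m'_def[abs_def] boundary_degree_add_edge_unit[OF D(1) that x(1) y(1)] boundary_degree_add_edge_unit[OF D(1) that v(1) x(1)]
        boundary_degree_add_edge_unit[OF D(1) that v(1) y(1)] ..
    then show ?thesis by auto
  qed
  have I': "admissible k W m' P R t X (S - {v})"
  proof (rule admissible_lower[OF I])
    show "m' u w = m' w u" "m' w w = 0" for u w
      using D(3)[of u w] D(5) x y edge_unit_sym[of v x u w] edge_unit_sym[of v y u w] edge_unit_sym[of x y u w]
      by (simp_all add: m'_def edge_unit_diag)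
    show "0 \<le> m' u w" for u w
      using D(4)[of u w] x y D(3)[of x v] D(3)[of y v] by (auto simp: m'_def edge_unit_def)
    show "boundary_degree W m P R A \<le> boundary_degree W m' P R A \<or>
        feasible k W m P R t (2 * k) A \<and> boundary_degree W m P R A - 2 \<le> boundary_degree W m' P R A"
      if A: "A \<noteq> {}" "A \<subset> W" "\<And>v. v \<in> X \<Longrightarrow> A \<noteq> {v}" for A
    proof (cases "(v \<in> A) \<noteq> (x \<in> A) \<and> (v \<in> A) \<noteq> (y \<in> A)")
      case True
      have "feasible k W m P R t (2 * k) A"
      proof (rule big_slackD[OF B D(1) A(1,2)])
        fix u assume "A = {u}"
        then have "A = {v}" "u = v" using True y by auto
        then show "feasible k W m P R t (2 * k) {u}" using v(2) A(3) by auto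
      qed
      then show ?thesis using b[of A] A(2) by auto
    next
      case False
      then show ?thesis using b[of A] A(2) by auto
    qed
    show "boundary_degree W m P R {u} \<le> boundary_degree W m' P R {u}" if "u \<in> S - {v}" for u
      using b[of "{u}"] that D(16) x y by auto
  qed (use D b in auto)
  have "cut_weight m' W W < cut_weight m W W"
    unfolding m'_def[abs_def] cut_weight_add cut_weight_scale cut_weight_edge_unit[OF D(1) D(1)] using v x y by simp
  then have "solvable k W m' P R t (S - {v})"
    using smaller_solvedD2[OF H I'] by simp
  then obtain f' where f': "orients W m' f'"
    "\<And>w. w \<in> W \<Longrightarrow> 2 * k dvd net_outdegree W f' w - P w + R w - t w"
    "\<And>w. w \<in> S - {v} \<Longrightarrow> \<bar>net_outdegree W f' w - P w + R w\<bar> \<le> boundary_degree W m' P R {w} - 2"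
    by (auto simp: solvable_def)
  \<comment> \<open>At least the lifted edge joins \<open>x\<close> and \<open>y\<close>, so there
    is an arc in one of the two directions; parallel edges are interchangeable.\<close>
  have "0 \<le> f' x y" "0 \<le> f' y x" "f' x y + f' y x = m x y + 1"
    using f'(1) x y by (auto simp: orients_def m'_def edge_unit_def)
  then have "1 \<le> f' x y \<or> 1 \<le> f' y x" using D(4)[of x y] by linarith
  then obtain p q where pq: "p = x \<and> q = y \<or> p = y \<and> q = x" "1 \<le> f' p q" by blast
  define f where "f u w = f' u w + (-1) * of_bool (u = p \<and> w = q) + 1 * of_bool (u = p \<and> w = v)
      + 1 * of_bool (u = v \<and> w = q)" for u w
  have n: "net_outdegree W f w = net_outdegree W f' w" for w
    unfolding f_def[abs_def] net_outdegree_add[OF D(1)] using v x y pq(1) by auto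
  have "orients W m f"
    unfolding orients_def
  proof (intro ballI)
    fix u w assume "u \<in> W" "w \<in> W"
    then have "0 \<le> f' u w" and s: "f' u w + f' w u = m' u w" using f'(1) by (auto simp: orients_def)
    then have "0 \<le> f u w" using pq(2) by (cases "u = p \<and> w = q") (auto simp: f_def)
    moreover have "f u w + f w u = f' u w + f' w u - edge_unit p q u w + edge_unit p v u w + edge_unit v q u w"
      by (simp add: f_def edge_unit_def conj_commute)
    moreover have "edge_unit p q u w = edge_unit x y u w" "edge_unit p v u w + edge_unit v q u w = edge_unit v x u w + edge_unit v y u w"
      using pq(1) by (elim disjE conjE; simp add: edge_unit_def add_ac)+
    ultimately show "0 \<le> f u w \<and> f u w + f w u = m u w"
      unfolding s m'_def by simp
  qed
  moreover have "\<bar>net_outdegree W f w - P w + R w\<bar> \<le> boundary_degree W m P R {w} - 2" if "w \<in> S" for w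
  proof (cases "w = v")
    case True
    have "\<bar>net_outdegree W f' v - P v + R v\<bar> \<le> boundary_degree W m' P R {v}"
      using admissibleD[OF I'] v f'(1) by (intro net_outdegree_bound) auto
    then show ?thesis using b[of "{v}"] v x y True n by auto
  next
    case False
    then have "boundary_degree W m' P R {w} = boundary_degree W m P R {w}" using b[of "{w}"] that D(16) y(4) by auto
    then show ?thesis using f'(3)[of w] that False n[of w] by auto
  qed
  ultimately show ?thesis
    using f'(2) n unfolding solvable_def by metis
qed

text \<open>The degenerate lifting with equal neighbours: two parallel edges are removed and put
  back with opposite orientations. Here \<open>x\<close> loses two boundary edges as well, hence its
  additional slack hypothesis.\<close>

lemma lift_parallel:
  assumes I: "admissible k W m P R t X S" and H: "smaller_solved k W m" and B: "big_slack k W m P R t"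
    and v: "v \<in> W" "v \<in> X \<or> feasible k W m P R t (2 * k) {v}"
    and x: "x \<in> W" "x \<noteq> v" "2 \<le> m v x" "feasible k W m P R t (2 * k) {x}"
  shows "solvable k W m P R t S"
proof -
  note D = admissibleD[OF I]
  define m' where "m' u w = m u w + (-2) * edge_unit v x u w" for u w
  have b: "boundary_degree W m' P R A = boundary_degree W m P R A - 2 * of_bool ((v \<in> A) \<noteq> (x \<in> A))"
    if "A \<subseteq> W" for A
    unfolding m'_def[abs_def] boundary_degree_add_edge_unit[OF D(1) that v(1) x(1)] by simp
  have I': "admissible k W m' P R t X (S - {v, x})"
  proof (rule admissible_lower[OF I])
    show "m' u w = m' w u" "m' w w = 0" for u w
      using D(3)[of u w] D(5) x edge_unit_sym[of v x u w] by (simp_all add: m'_def edge_unit_diag)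
    show "0 \<le> m' u w" for u w
      using D(4)[of u w] x D(3)[of x v] by (auto simp: m'_def edge_unit_def)
    show "boundary_degree W m P R A \<le> boundary_degree W m' P R A \<or>
        feasible k W m P R t (2 * k) A \<and> boundary_degree W m P R A - 2 \<le> boundary_degree W m' P R A"
      if A: "A \<noteq> {}" "A \<subset> W" "\<And>v. v \<in> X \<Longrightarrow> A \<noteq> {v}" for A
    proof (cases "(v \<in> A) \<noteq> (x \<in> A)")
      case True
      have "feasible k W m P R t (2 * k) A"
      proof (rule big_slackD[OF B D(1) A(1,2)])
        fix u assume "A = {u}"
        then have "u = v \<or> u = x" using True by auto
        then show "feasible k W m P R t (2 * k) {u}" using v(2) x(4) A(3) \<open>A = {u}\<close> by auto
      qed
      then show ?thesis using b[of A] A(2) by auto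
    next
      case False
      then show ?thesis using b[of A] A(2) by auto
    qed
    show "boundary_degree W m P R {u} \<le> boundary_degree W m' P R {u}" if "u \<in> S - {v, x}" for u
      using b[of "{u}"] that D(16) x by auto
  qed (use D b in auto)
  have "cut_weight m' W W < cut_weight m W W"
    unfolding m'_def[abs_def] cut_weight_add cut_weight_scale cut_weight_edge_unit[OF D(1) D(1)] using v x by simp
  then have "solvable k W m' P R t (S - {v, x})"
    using smaller_solvedD2[OF H I'] by simp
  then obtain f' where f': "orients W m' f'"
    "\<And>w. w \<in> W \<Longrightarrow> 2 * k dvd net_outdegree W f' w - P w + R w - t w"
    "\<And>w. w \<in> S - {v, x} \<Longrightarrow> \<bar>net_outdegree W f' w - P w + R w\<bar> \<le> boundary_degree W m' P R {w} - 2"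
    by (auto simp: solvable_def)
  define f where "f u w = f' u w + 1 * of_bool (u = v \<and> w = x) + 1 * of_bool (u = x \<and> w = v)" for u w
  have n: "net_outdegree W f w = net_outdegree W f' w" for w
    unfolding f_def[abs_def] net_outdegree_add[OF D(1)] using v x by simp
  have "orients W m f"
    unfolding f_def
  proof (intro orients_add_arc)
    have "(\<lambda>u w. m u w + (-1) * edge_unit x v u w + (-1) * edge_unit v x u w) = m'"
      by (intro ext) (simp add: m'_def edge_unit_def)
    then show "orients W (\<lambda>u w. m u w + (-1) * edge_unit x v u w + (-1) * edge_unit v x u w) f'"
      using f'(1) by simp
  qed
  moreover have "\<bar>net_outdegree W f w - P w + R w\<bar> \<le> boundary_degree W m P R {w} - 2" if "w \<in> S" for w
  proof (cases "w = v \<or> w = x")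
    case True
    have "\<bar>net_outdegree W f' w - P w + R w\<bar> \<le> boundary_degree W m' P R {w}"
      using admissibleD[OF I'] v x True f'(1) by (intro net_outdegree_bound) auto
    then show ?thesis using b[of "{w}"] v x True n by auto
  next
    case False
    then show ?thesis using f'(3)[of w] that b[of "{w}"] D(16) n[of w] by auto
  qed
  ultimately show ?thesis
    using f'(2) n unfolding solvable_def by metis
qed

section \<open>Boundary degrees of complements and pairs\<close>

lemma boundary_degree_compl:
  assumes "finite W" "\<And>u v. m u v = m v u" "A \<subseteq> W"
  shows "boundary_degree W m P R (W - A) = boundary_degree W m P R A - 2 * sum P A - 2 * sum R A + sum P W + sum R W"
proof -
  have "W - (W - A) = A" "cut_weight m (W - A) A = cut_weight m A (W - A)"
    using assms cut_weight_sym[of m] by auto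
  moreover have "sum P (W - A) = sum P W - sum P A" "sum R (W - A) = sum R W - sum R A"
    using assms by (simp_all add: sum_diff)
  ultimately show ?thesis by (simp add: boundary_degree_def)
qed

lemma boundary_degree_pair:
  assumes "finite W" "\<And>u v. m u v = m v u" "\<And>v. m v v = 0" "v \<in> W" "x \<in> W" "v \<noteq> x"
  shows "boundary_degree W m P R {v, x} = boundary_degree W m P R {v} + boundary_degree W m P R {x} - 2 * m v x"
proof -
  have "W - {v, x} = W - {v} - {x}" by auto
  then have "(\<Sum>u\<in>W - {v, x}. m w u) = (\<Sum>u\<in>W. m w u) - m w v - m w x" for w
    using assms by (simp add: sum_diff1)
  then show ?thesis using assms(2)[of x v] assms
    by (simp add: boundary_degree_single boundary_degree_def[of W m P R "{v, x}"] cut_weight_def)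
qed

lemma sum_eq_single:
  "finite W \<Longrightarrow> x \<in> W \<Longrightarrow> (\<And>y. y \<in> W \<Longrightarrow> y \<noteq> x \<Longrightarrow> h y = 0) \<Longrightarrow> sum h W = (h x :: int)"
  by (subst sum.remove[of W x]) auto

text \<open>The divisibility condition on the totals already is the demand at \<open>v\<close>. A
  mark is impossible, since it would need slack \<open>2 * k\<close> for all of \<open>W\<close>,
  against \<open>in_bounds_tight\<close>.\<close>

lemma solvable_singleton:
  assumes I: "admissible k {v} m P R t X S" and k: "0 < k"
  shows "solvable k {v} m P R t S"
proof -
  note D = admissibleD[OF I]
  have "2 * k dvd t v + P v - R v" using D(9) by simp
  then have d: "2 * k dvd - P v + R v - t v"
    using dvd_minus_iff[of "2 * k" "t v + P v - R v"] by (simp add: algebra_simps)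
  have "S = {}"
  proof (rule ccontr)
    assume "S \<noteq> {}"
    then have "feasible k {v} m P R t (2 * k) {v}" using D(16) D(17)[of v] by auto
    then obtain T where T: "2 * k dvd T - t v" "\<bar>T\<bar> \<le> P v + R v - 2 * k"
      by (auto simp: feasible_def boundary_degree_def cut_weight_def)
    have "2 * k dvd (T - t v) - (- P v + R v - t v)"
      using T(1) d by (rule dvd_diff)
    then have "2 * k dvd T - (R v - P v)" by (simp add: algebra_simps)
    then show False
      using in_bounds_tight[of k "P v" "R v" T] D(6)[of v] D(7)[of v] D(10) T(2) k by simp
  qed
  then show ?thesis
    using d D(5) unfolding solvable_def
    by (intro exI[of _ "\<lambda>_ _. 0"]) (simp add: orients_def net_outdegree_def)
qed

text \<open>A second edge at \<open>v\<close>, to \<open>z\<close> or to another neighbour, can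
  always be paired with vx. The only obstruction is that every edge at \<open>v\<close> leads to
  \<open>x\<close>, which is delegated to the hypothesis \<open>single\<close>.\<close>

lemma lift_vertex:
  assumes I: "admissible k W m P R t X S" and H: "smaller_solved k W m" and B: "big_slack k W m P R t"
    and v: "v \<in> W" "v \<in> X \<or> feasible k W m P R t (2 * k) {v}"
    and x: "x \<in> W" "x \<noteq> v" "0 < m v x"
    and single: "P v = 0 \<Longrightarrow> R v = 0 \<Longrightarrow> (\<And>y. y \<in> W \<Longrightarrow> y \<noteq> x \<Longrightarrow> m v y = 0) \<Longrightarrow>
      2 \<le> m v x \<and> feasible k W m P R t (2 * k) {x}"
  shows "solvable k W m P R t S"
proof -
  note D = admissibleD[OF I]
  consider "0 < P v" | "0 < R v" | y where "y \<in> W" "y \<noteq> v" "0 < m v y" "x \<noteq> y"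
    | "P v = 0" "R v = 0" "\<And>y. y \<in> W \<Longrightarrow> y \<noteq> x \<Longrightarrow> m v y = 0"
    using D(4,5,6,7) v(1) by (metis order_le_less)
  then show ?thesis
  proof cases
    case 1
    then show ?thesis using lift_prescribed[OF I H B v _ x] by simp
  next
    case 2
    then show ?thesis using lift_prescribed'[OF I H B v _ x] by simp
  next
    case 3
    then show ?thesis using lift_pair[OF I H B v x] by simp
  next
    case 4
    then show ?thesis using lift_parallel[OF I H B v x(1,2)] single by simp
  qed
qed

text \<open>The condition on \<open>W - {v}\<close> rewritten at \<open>v\<close>: it limits how
  many of the edges at \<open>v\<close> may lead to \<open>z\<close>.\<close>

lemma cond_compl_vertex:
  assumes I: "admissible k W m P R t X S" and v: "v \<in> W" "W \<noteq> {v}" "X \<subseteq> {v}"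
  obtains T where "2 * k dvd T - (sum R W - sum P W - t v)"
    "\<bar>T\<bar> \<le> boundary_degree W m P R {v} - 2 * P v - 2 * R v + sum P W + sum R W - (2 * k - 2)"
proof -
  note D = admissibleD[OF I]
  have "feasible k W m P R t (2 * k - 2) (W - {v})"
    using v by (intro D(11)) auto
  then obtain T where T: "2 * k dvd T - sum t (W - {v})" "\<bar>T\<bar> \<le> boundary_degree W m P R (W - {v}) - (2 * k - 2)"
    by (auto simp: feasible_def)
  have "2 * k dvd (T - sum t (W - {v})) + (sum t W + sum P W - sum R W)"
    using T(1) D(9) by (rule dvd_add)
  then have "2 * k dvd T - (sum R W - sum P W - t v)"
    using D(1) v(1) by (simp add: sum_diff1 algebra_simps)
  then show thesis
    using that T(2) boundary_degree_compl[of W m "{v}" P R, OF D(1) D(3)] v(1) by simp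
qed

lemma cond_compl_vertex_total:
  assumes "admissible k W m P R t X S" "v \<in> W" "W \<noteq> {v}" "X \<subseteq> {v}"
  shows "2 * k - 2 \<le> boundary_degree W m P R {v} - 2 * P v - 2 * R v + sum P W + sum R W"
  using assms by (rule cond_compl_vertex) linarith

lemma in_bounds_sum: "in_bounds k p r \<Longrightarrow> p + r \<le> 3 * k - 2"
  by (auto simp: in_bounds_def)

lemma neighbour_exists:
  assumes "admissible k W m P R t X S" "v \<in> W" "P v + R v < boundary_degree W m P R {v}"
  obtains x where "x \<in> W" "x \<noteq> v" "0 < m v x"
proof -
  note D = admissibleD[OF assms(1)]
  have "0 < (\<Sum>u\<in>W. m v u)" using assms(3) D(1,5) assms(2) by (simp add: boundary_degree_single)
  then obtain x where "x \<in> W" "m v x \<noteq> 0" by (metis order_less_irrefl sum.neutral)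
  then show thesis using that D(4,5) by (metis order_le_less)
qed

text \<open>A marked vertex has slack \<open>2 * k\<close> by definition, so an edge pair can be
  lifted there, and this settles the mark.\<close>

lemma marked_solved:
  assumes k: "3 \<le> k" and I: "admissible k W m P R t X S" and H: "smaller_solved k W m"
    and B: "big_slack k W m P R t" and W: "2 \<le> card W" and v: "v \<in> S"
  shows "solvable k W m P R t S"
proof -
  note D = admissibleD[OF I]
  have X: "X = {}" using D(14) v by auto
  have vW: "v \<in> W" "W \<noteq> {v}" using v D(16) W by auto
  have sl: "feasible k W m P R t (2 * k) {v}" using D(17) v .
  then obtain T where T: "2 * k dvd T - t v" "\<bar>T\<bar> \<le> boundary_degree W m P R {v} - 2 * k"
    by (auto simp: feasible_def)
  have nn: "0 \<le> P v" "0 \<le> R v" using D(6,7) vW by auto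
  \<comment> \<open>If all edges at \<open>v\<close> led to \<open>z\<close>, the condition on the
    complement would bound their number by (3k - 2) - (2k - 2) = k, whereas the slack requires at
    least 2k.\<close>
  have "P v + R v < boundary_degree W m P R {v}"
    using cond_compl_vertex_total[OF I vW] X in_bounds_sum[OF D(10)] T(2) nn k by auto
  then obtain x where x: "x \<in> W" "x \<noteq> v" "0 < m v x"
    by (rule neighbour_exists[OF I vW(1)])
  show ?thesis
  proof (rule lift_vertex[OF I H B vW(1) disjI2[OF sl] x])
    assume PR: "P v = 0" "R v = 0" and one: "\<And>y. y \<in> W \<Longrightarrow> y \<noteq> x \<Longrightarrow> m v y = 0"
    have bv: "boundary_degree W m P R {v} = m v x"
      using PR D(1,5) vW x one by (simp add: boundary_degree_single sum_eq_single)
    \<comment> \<open>All edges at \<open>v\<close> lead to \<open>x\<close>. If there is no third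
      vertex, the totals at \<open>z\<close> turn the witness \<open>T\<close> of \<open>v\<close>
      into one for \<open>x\<close>. Otherwise the difference of the witnesses of the pair and of
      \<open>v\<close> serves.\<close>
    have "feasible k W m P R t (2 * k) {x}"
    proof (cases "W = {v, x}")
      case True
      have "t v + t x = sum t W" using True x D(1) by simp
      moreover have "2 * k dvd - (T - t v) - (sum t W + sum P W - sum R W)"
        using dvd_diff[OF T(1)[THEN dvd_minus_iff[THEN iffD2]] D(9)] .
      moreover have eq: "- (T - t v) - (sum t W + sum P W - sum R W) = (sum R W - sum P W - T) - sum t {x}"
        using \<open>t v + t x = sum t W\<close> by simp
      ultimately have "2 * k dvd (sum R W - sum P W - T) - sum t {x}" by (simp only: eq)
      moreover have "boundary_degree W m P R {x} = boundary_degree W m P R {v} + sum P W + sum R W"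
        using boundary_degree_compl[of W m "{v}" P R, OF D(1) D(3)] PR True x(2)
        by (auto simp: insert_Diff_if)
      moreover have "0 \<le> sum P W" "0 \<le> sum R W" using D(6,7) by (auto intro: sum_nonneg)
      ultimately show ?thesis using T(2) unfolding feasible_def
        by (intro exI[of _ "sum R W - sum P W - T"]) auto
    next
      case False
      then have "feasible k W m P R t (2 * k) {v, x}"
      proof -
        have "{v, x} \<subset> W" "2 \<le> card {v, x}" using vW x(1,2) False by auto
        then show ?thesis using B unfolding big_slack_def by blast
      qed
      then obtain T' where T': "2 * k dvd T' - (t v + t x)" "\<bar>T'\<bar> \<le> boundary_degree W m P R {v, x} - 2 * k"
        using x(2) by (auto simp: feasible_def)
      have "2 * k dvd (T' - (t v + t x)) - (T - t v)" using T'(1) T(1) by (rule dvd_diff)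
      then have "2 * k dvd (T' - T) - sum t {x}" by (simp add: algebra_simps)
      moreover have "boundary_degree W m P R {v, x} = boundary_degree W m P R {x} - boundary_degree W m P R {v}"
        using boundary_degree_pair[of W m v x P R, OF D(1) D(3) D(5) vW(1) x(1)] x(2) bv by simp
      ultimately show ?thesis using T(2) T'(2) k unfolding feasible_def
        by (intro exI[of _ "T' - T"]) auto
    qed
    moreover have "2 \<le> m v x" using bv T(2) k by linarith
    ultimately show "2 \<le> m v x \<and> feasible k W m P R t (2 * k) {x}" by simp
  qed
qed

lemma in_bounds_mono: "in_bounds k p r \<Longrightarrow> p' \<le> p \<Longrightarrow> r' \<le> r \<Longrightarrow> in_bounds k p' r'"
  by (auto simp: in_bounds_def)

text \<open>
  All remaining edges at \<open>v\<close> leave \<open>v\<close>, so that \<open>v\<close> can be merged into \<open>z\<close>.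
\<close>

lemma absorb_exempt:
  assumes I: "admissible k W m P R t X S" and H: "smaller_solved k W m"
    and v: "v \<in> X" "W \<noteq> {v}" and c: "(\<Sum>u\<in>W. m v u) = P v - R v"
  shows "solvable k W m P R t S"
proof -
  note D = admissibleD[OF I]
  have X: "X = {v}" "v \<in> W" "S = {}" "2 * k dvd t v" using D(12,13,14,15)[OF v(1)] by auto
  define W' where "W' = W - {v}"
  have W: "W = insert v W'" "v \<notin> W'" "finite W'" using X(2) D(1) by (auto simp: W'_def)
  \<comment> \<open>Edges from \<open>v\<close> to \<open>y\<close> become edges from
    \<open>z\<close> to \<open>y\<close>.\<close>
  define P' where "P' y = P y + m v y" for y
  have b: "boundary_degree W' m P' R A = boundary_degree W m P R A" if "A \<subseteq> W'" for A
  proof -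
    have "W - A = (W' - A) \<union> {v}" using that W by auto
    then have "cut_weight m A (W - A) = cut_weight m A (W' - A) + cut_weight m A {v}"
      using W(2,3) by (simp add: cut_weight_Un_right del: Un_insert_right)
    then show ?thesis by (simp add: boundary_degree_def P'_def sum.distrib cut_weight_def D(3)[of _ v])
  qed
  \<comment> \<open>The \<open>P v\<close> arcs from \<open>z\<close> to \<open>v\<close> disappear
    and P v - R v new ones from \<open>z\<close> replace them, so neither total grows and
    \<open>in_bounds\<close> is kept.\<close>
  have s: "sum P' W' = sum P W - R v" "sum R W' = sum R W - R v" "sum t W' = sum t W - t v"
    using c W D(5)[of v] by (simp_all add: P'_def sum.distrib)
  have I': "admissible k W' m P' R t {} {}"
  proof (rule admissibleI)
    show "W' \<noteq> {}" using v(2) W by auto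
    show "even (t u - boundary_degree W' m P' R {u})" if "u \<in> W'" for u
      using D(8)[of u] that W by (simp add: b)
    have "2 * k dvd (sum t W + sum P W - sum R W) - t v"
      using D(9) X(4) by (rule dvd_diff)
    then show "2 * k dvd sum t W' + sum P' W' - sum R W'"
      by (simp add: s algebra_simps)
    show "in_bounds k (sum P' W') (sum R W')"
      using D(10) D(7)[OF X(2)] s by (auto intro: in_bounds_mono)
    show "feasible k W' m P' R t (2 * k - 2) A" if "A \<noteq> {}" "A \<subset> W'" for A
    proof -
      have "feasible k W m P R t (2 * k - 2) A"
        using that W X(1) by (intro D(11)) auto
      then show ?thesis using b[of A] that by (auto simp: feasible_def)
    qed
  qed (use D W in \<open>auto simp: P'_def\<close>)
  have "card W' < card W" using W by simp
  then have "solvable k W' m P' R t {}" using smaller_solvedD1[OF H I'] by simp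
  then obtain f' where f': "orients W' m f'"
    "\<And>u. u \<in> W' \<Longrightarrow> 2 * k dvd net_outdegree W' f' u - P' u + R u - t u"
    by (auto simp: solvable_def)
  define f where "f u w = (if u = v then m v w else if w = v then 0 else f' u w)" for u w
  have "orients W m f"
    using f'(1) D(3)[of _ v] D(4,5) W by (auto simp: orients_def f_def)
  moreover have "net_outdegree W f v = P v - R v"
  proof -
    have "net_outdegree W f v = (\<Sum>u\<in>W. m v u)"
      unfolding net_outdegree_def using D(5) by (intro sum.cong) (auto simp: f_def)
    then show ?thesis using c by simp
  qed
  moreover have nt: "net_outdegree W f u = net_outdegree W' f' u - m v u" if "u \<in> W'" for u
  proof -
    have "u \<noteq> v" using that W by auto
    moreover have "(\<Sum>w\<in>W'. f u w - f w u) = (\<Sum>w\<in>W'. f' u w - f' w u)"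
      using that W by (intro sum.cong) (auto simp: f_def)
    ultimately show ?thesis unfolding net_outdegree_def W(1) using W(2,3) by (simp add: f_def)
  qed
  moreover have "2 * k dvd net_outdegree W f u - P u + R u - t u" if "u \<in> W'" for u
    using f'(2)[OF that] unfolding nt[OF that] P'_def by (simp add: algebra_simps)
  moreover have "2 * k dvd - t v" using X(4) by simp
  ultimately have "2 * k dvd net_outdegree W f u - P u + R u - t u" if "u \<in> W" for u
    using that W(1) by auto
  then show ?thesis
    unfolding solvable_def using X(3) \<open>orients W m f\<close> by auto
qed

text \<open>The demand at \<open>v\<close> is 0 modulo 2k, so \<open>v\<close> may be dissolved by
  lifting its edges in pairs. What must be shown is that the edges to \<open>z\<close> never
  outnumber those inside \<open>W\<close>; when lifting ends, \<open>v\<close> is balanced and can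
  be absorbed into \<open>z\<close>.\<close>

lemma exempt_solved:
  assumes k: "3 \<le> k" and I: "admissible k W m P R t X S" and H: "smaller_solved k W m"
    and B: "big_slack k W m P R t" and v: "v \<in> X"
  shows "solvable k W m P R t S"
proof -
  note D = admissibleD[OF I]
  have X: "X = {v}" "v \<in> W" "S = {}" "2 * k dvd t v" using D(12,13,14,15)[OF v] by auto
  define c where "c = (\<Sum>u\<in>W. m v u)"
  have bv: "boundary_degree W m P R {v} = c + P v + R v"
    using D(1,5) X(2) by (simp add: boundary_degree_single c_def)
  have nn: "0 \<le> P v" "0 \<le> R v" using D(6,7) X(2) by auto
  have "even (t v)" using X(4) by (meson dvd_trans dvd_triv_left)
  then have ev: "even (c + P v + R v)" using D(8)[OF X(2)] bv by simp
  show ?thesis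
  proof (cases "W = {v}")
    case True
    then show ?thesis using solvable_singleton[of k v m P R t X S] I k by auto
  next
    case False
    obtain T where T: "2 * k dvd T - (sum R W - sum P W - t v)"
      "\<bar>T\<bar> \<le> boundary_degree W m P R {v} - 2 * P v - 2 * R v + sum P W + sum R W - (2 * k - 2)"
      using cond_compl_vertex[OF I X(2) False] X(1) by auto
    have "2 * k dvd (T - (sum R W - sum P W - t v)) - t v"
      using T(1) X(4) by (rule dvd_diff)
    then have "2 * k dvd T - (sum R W - sum P W)" by (simp add: algebra_simps)
    moreover have "0 \<le> sum P W" "0 \<le> sum R W" using D(6,7) by (auto intro: sum_nonneg)
    \<comment> \<open>As the demand at \<open>v\<close> vanishes, the complement of \<open>v\<close>
      has the residue of all of \<open>W\<close>. That \<open>W\<close> lacks slack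
      \<open>2 * k\<close> thus bounds the edges between \<open>v\<close> and \<open>z\<close>;
      parity then improves the bound by one.\<close>
    ultimately have "sum P W + sum R W - 2 * k < \<bar>T\<bar>"
      using in_bounds_tight[OF D(10)] k by simp
    then have "P v + R v < c + 2" using T(2) bv by simp
    then have cl: "P v + R v \<le> c"
      using ev by presburger
    consider "c = P v - R v" | "c = R v - P v" | "\<bar>P v - R v\<bar> < c"
      using cl nn by linarith
    then show ?thesis
    proof cases
      case 1
      then show ?thesis using absorb_exempt[OF I H v False] by (simp add: c_def)
    next
      case 2
      then have "(\<Sum>u\<in>W. m v u) = R v - P v" by (simp add: c_def)
      then show ?thesis
        by (rule solvable_swap[OF absorb_exempt[OF admissible_swap[OF I] H v False]])
    next
      case 3
      then have "P v + R v < boundary_degree W m P R {v}" using bv by simp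
      then obtain x where x: "x \<in> W" "x \<noteq> v" "0 < m v x"
        by (rule neighbour_exists[OF I X(2)])
      show ?thesis
      proof (cases "W = {v, x} \<and> P v = 0 \<and> R v = 0")
        case True
        have c: "c = m v x" using True D(5)[of v] x(2) by (simp add: c_def)
        \<comment> \<open>With two vertices and no edges from \<open>v\<close> to \<open>z\<close>,
          half of the evenly many edges go each way.\<close>
        define f where "f u w = (if u = w then 0 else c div 2)" for u w :: 'a
        have n: "net_outdegree W f u = 0" for u by (simp add: net_outdegree_def f_def eq_commute)
        have "orients W m f"
          using True ev D(3)[of x v] D(5) c nn x(3) by (auto simp: orients_def f_def)
        moreover have "2 * k dvd - P u + R u - t u" if "u \<in> W" for u
        proof (cases "u = v")
          case False
          then have u: "u = x" using that True by auto
          have "2 * k dvd t v - (sum t W + sum P W - sum R W)"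
            using X(4) D(9) by (rule dvd_diff)
          then show ?thesis using u True x(2) by (simp add: algebra_simps)
        qed (use True X(4) in simp)
        ultimately show ?thesis unfolding solvable_def using X(3) n by (intro exI[of _ f]) simp
      next
        case W: False
        show ?thesis
        proof (rule lift_vertex[OF I H B X(2) disjI1[OF v] x])
          assume PR: "P v = 0" "R v = 0" and one: "\<And>y. y \<in> W \<Longrightarrow> y \<noteq> x \<Longrightarrow> m v y = 0"
          have c: "c = m v x" using D(1) x one unfolding c_def by (intro sum_eq_single) auto
          have "2 \<le> m v x" using ev PR c x(3) by (cases "m v x = 1") auto
          moreover have "feasible k W m P R t (2 * k) {v, x}"
          proof -
            have "{v, x} \<subset> W" "2 \<le> card {v, x}" using X(2) x(1,2) W PR by auto
            then show ?thesis using B unfolding big_slack_def by blast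
          qed
          then obtain T' where T': "2 * k dvd T' - (t v + t x)" "\<bar>T'\<bar> \<le> boundary_degree W m P R {v, x} - 2 * k"
            using x(2) by (auto simp: feasible_def)
          have "2 * k dvd (T' - (t v + t x)) + t v" using T'(1) X(4) by (rule dvd_add)
          then have "2 * k dvd T' - sum t {x}" by (simp add: algebra_simps)
          moreover have "boundary_degree W m P R {v, x} = boundary_degree W m P R {x} - c"
            using boundary_degree_pair[of W m v x P R, OF D(1) D(3) D(5) X(2) x(1)] x(2) bv c PR by simp
          ultimately show "2 \<le> m v x \<and> feasible k W m P R t (2 * k) {x}"
            using T'(2) c x(3) unfolding feasible_def by (intro conjI exI[of _ T']) auto
        qed
      qed
    qed
  qed
qed

section \<open>Deleting edges\<close>

text \<open>
  The vertex condition survives the deletion of an outgoing, respectively incoming, edge at \<open>v\<close>.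
\<close>

definition can_out :: "int \<Rightarrow> 'v set \<Rightarrow> ('v \<Rightarrow> 'v \<Rightarrow> int) \<Rightarrow> ('v \<Rightarrow> int) \<Rightarrow> ('v \<Rightarrow> int) \<Rightarrow> ('v \<Rightarrow> int) \<Rightarrow> 'v \<Rightarrow> bool" where
  "can_out k W m P R t v \<longleftrightarrow> (\<exists>T. 2 * k dvd T - t v \<and>
     2 * k - boundary_degree W m P R {v} \<le> T \<and> T \<le> boundary_degree W m P R {v} - 2 * k + 2)"

definition can_in :: "int \<Rightarrow> 'v set \<Rightarrow> ('v \<Rightarrow> 'v \<Rightarrow> int) \<Rightarrow> ('v \<Rightarrow> int) \<Rightarrow> ('v \<Rightarrow> int) \<Rightarrow> ('v \<Rightarrow> int) \<Rightarrow> 'v \<Rightarrow> bool" where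
  "can_in k W m P R t v \<longleftrightarrow> (\<exists>T. 2 * k dvd T - t v \<and>
     2 * k - 2 - boundary_degree W m P R {v} \<le> T \<and> T \<le> boundary_degree W m P R {v} - 2 * k)"

lemma can_swap:
  "can_out k W m R P (\<lambda>v. - t v) v = can_in k W m P R t v"
  "can_in k W m R P (\<lambda>v. - t v) v = can_out k W m P R t v"
proof -
  have dv: "2 * k dvd - T - - t v \<longleftrightarrow> 2 * k dvd T - t v" for T
    using dvd_minus_iff[of "2 * k" "T - t v"] by (simp add: algebra_simps)
  have ex: "(\<exists>T. Q T) = (\<exists>T. Q (- T))" for Q :: "int \<Rightarrow> bool"
    by (metis minus_minus)
  have 1: "(2 * k - b \<le> - T \<and> - T \<le> b - 2 * k + 2) = (2 * k - 2 - b \<le> T \<and> T \<le> b - 2 * k)" for b T :: int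
    by linarith
  have 2: "(2 * k - 2 - b \<le> - T \<and> - T \<le> b - 2 * k) = (2 * k - b \<le> T \<and> T \<le> b - 2 * k + 2)" for b T :: int
    by linarith
  show "can_out k W m R P (\<lambda>v. - t v) v = can_in k W m P R t v"
    unfolding can_out_def can_in_def boundary_degree_swap[of W m R P] by (subst ex) (simp only: dv 1)
  show "can_in k W m R P (\<lambda>v. - t v) v = can_out k W m P R t v"
    unfolding can_out_def can_in_def boundary_degree_swap[of W m R P] by (subst ex) (simp only: dv 2)
qed

text \<open>\<open>W\<close> is connected even without \<open>z\<close>: the boundary degrees of
  \<open>A\<close> and \<open>W - A\<close> add up to at least 4k - 4, and the edges at
  \<open>z\<close> account for at most 3k - 2 of this.\<close>

lemma edge_leaving:
  assumes k: "3 \<le> k" and I: "admissible k W m P R t {} S" and A: "A \<noteq> {}" "A \<subset> W"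
  obtains x y where "x \<in> A" "y \<in> W - A" "0 < m x y"
proof -
  note D = admissibleD[OF I]
  have "feasible k W m P R t (2 * k - 2) A" "feasible k W m P R t (2 * k - 2) (W - A)"
    using A by (auto intro!: D(11))
  then have "2 * k - 2 \<le> boundary_degree W m P R A" "2 * k - 2 \<le> boundary_degree W m P R (W - A)"
    by (auto simp: feasible_def)
  moreover have "boundary_degree W m P R (W - A) = boundary_degree W m P R A - 2 * sum P A - 2 * sum R A + sum P W + sum R W"
    using A(2) by (intro boundary_degree_compl[OF D(1) D(3)]) auto
  ultimately have "cut_weight m A (W - A) > 0"
    using in_bounds_sum[OF D(10)] k by (simp add: boundary_degree_def)
  moreover have "cut_weight m A (W - A) = 0" if "\<forall>x\<in>A. \<forall>y\<in>W - A. m x y = 0"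
    using that by (simp add: cut_weight_def)
  ultimately have "\<not> (\<forall>x\<in>A. \<forall>y\<in>W - A. m x y = 0)" by fastforce
  then show thesis using that D(4) by (metis order_le_less)
qed

text \<open>
  Before the edge is oriented from \<open>x\<close> to \<open>y\<close> and deleted, \<open>j\<close> edges from \<open>y\<close> to \<open>z\<close> are added.
\<close>

lemma delete_edge:
  fixes j :: int
  assumes I: "admissible k W m P R t {} {}" and H: "smaller_solved k W m" and B: "big_slack k W m P R t"
    and xy: "x \<in> W" "y \<in> W" "x \<noteq> y" "0 < m x y"
    and x: "can_out k W m P R t x"
    and j: "0 \<le> j" "in_bounds k (sum P W) (sum R W + j)"
    and y: "2 * k dvd T - (t y + j)" "2 * k - 2 - boundary_degree W m P R {y} - j \<le> T" "T \<le> boundary_degree W m P R {y} + j - 2 * k"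
  shows "solvable k W m P R t {}"
proof -
  note D = admissibleD[OF I]
  define m' where "m' u w = m u w + (-1) * edge_unit x y u w" for u w
  define R' where "R' u = R u + j * of_bool (u = y)" for u
  \<comment> \<open>Deleting the arc from \<open>x\<close> to \<open>y\<close> lowers the net
    outdegree of \<open>x\<close> by 1 and raises that of \<open>y\<close> by 1; the
    \<open>j\<close> new arcs to \<open>z\<close> raise the latter further.\<close>
  define t' where "t' u = t u + (-1) * of_bool (u = x) + (1 + j) * of_bool (u = y)" for u
  have fin: "finite A" if "A \<subseteq> W" for A using that D(1) by (rule finite_subset)
  have b: "boundary_degree W m' P R' A = boundary_degree W m P R A + j * of_bool (y \<in> A) - of_bool ((x \<in> A) \<noteq> (y \<in> A))"
    if "A \<subseteq> W" for A
    unfolding m'_def[abs_def] R'_def[abs_def] boundary_degree_add_edge_unit[OF D(1) that xy(1,2)] boundary_degree_add_R[OF fin[OF that]]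
    by simp
  have st: "sum t' A = sum t A - of_bool (x \<in> A) + (1 + j) * of_bool (y \<in> A)" if "A \<subseteq> W" for A
    unfolding t'_def[abs_def] sum_point[OF fin[OF that]] by simp
  have sR: "sum R' W = sum R W + j"
    unfolding R'_def[abs_def] sum_point[OF D(1)] using xy by simp
  have I': "admissible k W m' P R' t' {} {}"
  proof (rule admissibleI)
    show "m' u w = m' w u" "m' w w = 0" for u w
      using D(3)[of u w] D(5) xy edge_unit_sym[of x y u w] by (simp_all add: m'_def edge_unit_diag)
    show "0 \<le> m' u w" for u w
      using D(4)[of u w] xy D(3)[of x y] by (auto simp: m'_def edge_unit_def)
    show "0 \<le> R' v" if "v \<in> W" for v using D(7)[OF that] j(1) by (simp add: R'_def)
    show "even (t' v - boundary_degree W m' P R' {v})" if "v \<in> W" for v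
      using D(8)[OF that] that xy by (auto simp: b t'_def)
    show "2 * k dvd sum t' W + sum P W - sum R' W"
    proof -
      have "sum t' W + sum P W - sum R' W = sum t W + sum P W - sum R W" using xy by (simp add: st sR)
      then show ?thesis using D(9) by (simp only:)
    qed
    show "in_bounds k (sum P W) (sum R' W)" using j(2) by (simp add: sR)
    show "feasible k W m' P R' t' (2 * k - 2) A" if A: "A \<noteq> {}" "A \<subset> W" for A
    proof -
      have AW: "A \<subseteq> W" using A by auto
      consider "A = {x}" | "A = {y}" | v where "A = {v}" "v \<noteq> x" "v \<noteq> y" | "\<And>v. A \<noteq> {v}" by blast
      then show ?thesis
      proof cases
        case 1
        then obtain T where "2 * k dvd T - t x" "2 * k - boundary_degree W m P R {x} \<le> T" "T \<le> boundary_degree W m P R {x} - 2 * k + 2"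
          using x by (auto simp: can_out_def)
        then show ?thesis unfolding feasible_def
          using 1 b[OF AW] st[OF AW] xy(3) by (intro exI[of _ "T - 1"]) (auto simp: algebra_simps)
      next
        case 2
        then show ?thesis unfolding feasible_def
          using y b[OF AW] st[OF AW] xy(3) by (intro exI[of _ "T + 1"]) (auto simp: algebra_simps)
      next
        case 3
        then show ?thesis using D(11)[OF A] b[OF AW] st[OF AW] unfolding feasible_def by auto
      next
        case 4
        \<comment> \<open>Larger sets are safe: demand and boundary degree grow together under the
          \<open>j\<close> new arcs, and the slack \<open>2 * k\<close> covers the lost
          edge.\<close>
        then have "feasible k W m P R t (2 * k) A" using big_slackD[OF B D(1) A] by auto
        then obtain T where T: "2 * k dvd T - sum t A" "\<bar>T\<bar> \<le> boundary_degree W m P R A - 2 * k"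
          by (auto simp: feasible_def)
        show ?thesis unfolding feasible_def
          using T b[OF AW] st[OF AW] j(1)
          by (intro exI[of _ "T - of_bool (x \<in> A) + (1 + j) * of_bool (y \<in> A)"])
            (cases "x \<in> A"; cases "y \<in> A"; simp)
      qed
    qed
  qed (use D in auto)
  have "cut_weight m' W W < cut_weight m W W"
    unfolding m'_def[abs_def] cut_weight_add cut_weight_scale cut_weight_edge_unit[OF D(1) D(1)] using xy by simp
  then have "solvable k W m' P R' t' {}"
    using smaller_solvedD2[OF H I'] by simp
  then obtain f' where f': "orients W m' f'"
    "\<And>w. w \<in> W \<Longrightarrow> 2 * k dvd net_outdegree W f' w - P w + R' w - t' w"
    by (auto simp: solvable_def)
  define f where "f u w = f' u w + 1 * of_bool (u = x \<and> w = y)" for u w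
  have n: "net_outdegree W f w + R w - t w = net_outdegree W f' w + R' w - t' w" for w
    unfolding f_def[abs_def] net_outdegree_add[OF D(1)] R'_def t'_def using xy
    by (simp add: algebra_simps)
  have "2 * k dvd net_outdegree W f w - P w + R w - t w" if "w \<in> W" for w
  proof -
    have "net_outdegree W f w - P w + R w - t w = net_outdegree W f' w - P w + R' w - t' w" using n[of w] by simp
    then show ?thesis using f'(2)[OF that] by (simp only:)
  qed
  moreover have "orients W m f"
    using f'(1) unfolding m'_def f_def by (rule orients_add_arc)
  ultimately show ?thesis unfolding solvable_def by auto
qed

text \<open>Forgetting an arc from \<open>v\<close> to \<open>z\<close> and lowering the demand of
  \<open>v\<close> by 1 leaves the task inside \<open>W\<close> unchanged. Progress is measured by
  the edges at \<open>z\<close> alone, hence the separate hypothesis \<open>H\<close>.\<close>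

lemma reclaim:
  assumes I: "admissible k W m P R t {} {}" and B: "big_slack k W m P R t"
    and H: "\<And>P' R' t'. admissible k W m P' R' t' {} {} \<Longrightarrow> sum P' W + sum R' W < sum P W + sum R W \<Longrightarrow> solvable k W m P' R' t' {}"
    and v: "v \<in> W" "0 < R v" "can_out k W m P R t v"
  shows "solvable k W m P R t {}"
proof -
  note D = admissibleD[OF I]
  define R' where "R' u = R u + (-1) * of_bool (u = v)" for u
  define t' where "t' u = t u + (-1) * of_bool (u = v)" for u
  have fin: "finite A" if "A \<subseteq> W" for A using that D(1) by (rule finite_subset)
  have b: "boundary_degree W m P R' A = boundary_degree W m P R A - of_bool (v \<in> A)" if "A \<subseteq> W" for A
    unfolding R'_def[abs_def] boundary_degree_add_R[OF fin[OF that]] by simp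
  have st: "sum t' A = sum t A - of_bool (v \<in> A)" if "A \<subseteq> W" for A
    unfolding t'_def[abs_def] sum_point[OF fin[OF that]] by simp
  have sR: "sum R' W = sum R W - 1"
    unfolding R'_def[abs_def] sum_point[OF D(1)] using v by simp
  have I': "admissible k W m P R' t' {} {}"
  proof (rule admissibleI)
    show "0 \<le> R' u" if "u \<in> W" for u using D(7)[OF that] v(2) by (auto simp: R'_def)
    show "even (t' u - boundary_degree W m P R' {u})" if "u \<in> W" for u
      using D(8)[OF that] that v by (auto simp: b t'_def)
    show "2 * k dvd sum t' W + sum P W - sum R' W"
    proof -
      have "sum t' W + sum P W - sum R' W = sum t W + sum P W - sum R W" using v by (simp add: st sR)
      then show ?thesis using D(9) by (simp only:)
    qed
    show "in_bounds k (sum P W) (sum R' W)" using D(10) by (rule in_bounds_mono) (auto simp: sR)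
    show "feasible k W m P R' t' (2 * k - 2) A" if A: "A \<noteq> {}" "A \<subset> W" for A
    proof -
      have AW: "A \<subseteq> W" using A by auto
      consider "A = {v}" | "v \<notin> A" | "v \<in> A" "\<And>u. A \<noteq> {u}" by blast
      then show ?thesis
      proof cases
        case 1
        then obtain T where "2 * k dvd T - t v" "2 * k - boundary_degree W m P R {v} \<le> T" "T \<le> boundary_degree W m P R {v} - 2 * k + 2"
          using v by (auto simp: can_out_def)
        then show ?thesis unfolding feasible_def
          using 1 b[OF AW] st[OF AW] by (intro exI[of _ "T - 1"]) (auto simp: algebra_simps)
      next
        case 2
        then show ?thesis using D(11)[OF A] b[OF AW] st[OF AW] unfolding feasible_def by auto
      next
        case 3
        then have "feasible k W m P R t (2 * k) A" using big_slackD[OF B D(1) A] by auto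
        then obtain T where T: "2 * k dvd T - sum t A" "\<bar>T\<bar> \<le> boundary_degree W m P R A - 2 * k"
          by (auto simp: feasible_def)
        then show ?thesis unfolding feasible_def
          using 3(1) b[OF AW] st[OF AW] by (intro exI[of _ "T - 1"]) auto
      qed
    qed
  qed (use D in auto)
  then have "solvable k W m P R' t' {}" using H sR by simp
  moreover have "- P u + R' u - t' u = - P u + R u - t u" for u by (simp add: R'_def t'_def)
  ultimately show ?thesis unfolding solvable_def by (simp add: add_diff_eq diff_add_eq R'_def t'_def)
qed

text \<open>Once \<open>R\<close> vanishes, \<open>in_bounds\<close> leaves room for k - 1 arcs to
  \<open>z\<close>. Up to k - 1 of them at \<open>y\<close> shift its demand so far that another
  representative of the residue lets it lose an incoming edge.\<close>

lemma all_out_solved: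
  assumes k: "3 \<le> k" and I: "admissible k W m P R t {} {}" and H: "smaller_solved k W m"
    and B: "big_slack k W m P R t" and W: "2 \<le> card W"
    and H': "\<And>P' R' t'. admissible k W m P' R' t' {} {} \<Longrightarrow> sum P' W + sum R' W < sum P W + sum R W \<Longrightarrow> solvable k W m P' R' t' {}"
    and out: "\<And>v. v \<in> W \<Longrightarrow> can_out k W m P R t v" "\<And>v. v \<in> W \<Longrightarrow> \<not> can_in k W m P R t v"
  shows "solvable k W m P R t {}"
proof (cases "\<exists>v\<in>W. 0 < R v")
  case True
  then show ?thesis using reclaim[OF I B H'] out(1) by blast
next
  case False
  note D = admissibleD[OF I]
  have "R v = 0" if "v \<in> W" for v using False D(7)[OF that] that by (metis order_le_less)
  then have R: "sum R W = 0" by simp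
  obtain x where xW: "x \<in> W" using D(2) by auto
  then have "{x} \<subset> W" using W by auto
  then obtain y where y: "y \<in> W" "x \<noteq> y" "0 < m x y"
    using edge_leaving[OF k I, of "{x}"] by auto
  define d where "d = boundary_degree W m P R {y}"
  have "{y} \<subset> W" using W y(1) by auto
  then have "feasible k W m P R t (2 * k - 2) {y}" by (intro D(11)) auto
  then obtain T where T: "2 * k dvd T - t y" "\<bar>T\<bar> \<le> d - (2 * k - 2)" by (auto simp: feasible_def d_def)
  have no: "\<not> (2 * k - 2 - d \<le> T' \<and> T' \<le> d - 2 * k)" if "2 * k dvd T' - t y" for T'
    using out(2)[OF y(1)] that by (auto simp: can_in_def d_def)
  have "even (T - t y)" using T(1) by (meson dvd_trans dvd_triv_left)
  then have "even (T - d)" using D(8)[OF y(1)] by (simp add: d_def)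
  moreover have "d - 2 * k < T" using no[OF T(1)] T(2) by linarith
  ultimately have Td: "T = d - 2 * k + 2" using T(2) by presburger
  have "2 * k dvd (T - 2 * k) - t y"
    using dvd_diff[OF T(1) dvd_refl] by (simp add: algebra_simps)
  \<comment> \<open>\<open>T - 2 * k\<close> meets the upper bound of \<open>can_in\<close>, so it
    must violate the lower one, which by \<open>Td\<close> equals - T.\<close>
  then have Tk: "T < k" using no[of "T - 2 * k"] Td k by linarith
  have "1 \<le> T" using out(1)[OF y(1)] Td by (auto simp: can_out_def d_def)
  \<comment> \<open>Adding \<open>j\<close> turns the representative T - 2k into - k, which is
    exactly the lower bound that \<open>delete_edge\<close> asks for. Since \<open>T\<close> is at
    least 1, \<open>j\<close> is at most k - 1.\<close>
  define j where "j = k - T"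
  have "2 * k dvd (T - 2 * k - t y)" by fact
  moreover have "T - 2 * k - t y = - k - (t y + j)" by (simp add: j_def)
  ultimately have "2 * k dvd - k - (t y + j)" by simp
  then show ?thesis
  proof (rule delete_edge[OF I H B xW y out(1)[OF xW], rotated 2])
    show "0 \<le> j" using Tk by (simp add: j_def)
    show "in_bounds k (sum P W) (sum R W + j)"
      using D(10) R \<open>1 \<le> T\<close> k by (auto simp: in_bounds_def j_def)
    show "2 * k - 2 - boundary_degree W m P R {y} - j \<le> - k" "- k \<le> boundary_degree W m P R {y} + j - 2 * k"
      using Td k by (simp_all add: j_def flip: d_def)
  qed
qed

text \<open>A vertex that can spare no edge at all has demand 0 modulo 2k and is made exempt.
  Otherwise either some edge can be deleted, or by connectivity all vertices are of the same
  kind.\<close>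

lemma plain_solved:
  assumes k: "3 \<le> k" and I: "admissible k W m P R t {} {}" and H: "smaller_solved k W m"
    and B: "big_slack k W m P R t"
    and H': "\<And>P' R' t'. admissible k W m P' R' t' {} {} \<Longrightarrow> sum P' W + sum R' W < sum P W + sum R W \<Longrightarrow> solvable k W m P' R' t' {}"
    and W: "2 \<le> card W"
  shows "solvable k W m P R t {}"
proof -
  note D = admissibleD[OF I]
  let ?out = "can_out k W m P R t" and ?in = "can_in k W m P R t"
  have sing: "{v} \<subset> W" if "v \<in> W" for v using that W by auto
  show ?thesis
  proof (cases "\<exists>v\<in>W. \<not> ?out v \<and> \<not> ?in v")
    case True
    then obtain v where v: "v \<in> W" "\<not> ?out v" "\<not> ?in v" by auto
    define d where "d = boundary_degree W m P R {v}"
    have "feasible k W m P R t (2 * k - 2) {v}" using sing[OF v(1)] by (intro D(11)) auto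
    then obtain T where T: "2 * k dvd T - t v" "\<bar>T\<bar> \<le> d - (2 * k - 2)" by (auto simp: feasible_def d_def)
    have "even (T - t v)" using T(1) by (meson dvd_trans dvd_triv_left)
    then have ev: "even (T - d)" using D(8)[OF v(1)] by (simp add: d_def)
    have "\<not> (2 * k - d \<le> T \<and> T \<le> d - 2 * k + 2)" "\<not> (2 * k - 2 - d \<le> T \<and> T \<le> d - 2 * k)"
      using v(2,3) T(1) unfolding can_out_def can_in_def d_def by blast+
    then have "T < 2 * k - d" "d - 2 * k < T" using T(2) by linarith+
    \<comment> \<open>By parity d - 2k + 2 \<le> T \<le> - (d - 2k + 2); with the bound on the
      absolute value, T equals both ends.\<close>
    then have "T = 0" using ev T(2) by presburger
    then have "2 * k dvd t v" using T(1) dvd_minus_iff[of "2 * k" "t v"] by simp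
    then have "admissible k W m P R t {v} {}"
      using D v(1) by (intro admissibleI) auto
    then show ?thesis using exempt_solved[OF k _ H B] by blast
  next
    case one: False
    show ?thesis
    proof (cases "\<exists>x\<in>W. \<exists>y\<in>W. x \<noteq> y \<and> 0 < m x y \<and> ?out x \<and> ?in y")
      case True
      then obtain x y T where "x \<in> W" "y \<in> W" "x \<noteq> y" "0 < m x y" "?out x"
        "2 * k dvd T - t y" "2 * k - 2 - boundary_degree W m P R {y} \<le> T" "T \<le> boundary_degree W m P R {y} - 2 * k"
        by (auto simp: can_in_def)
      then show ?thesis using delete_edge[OF I H B, of x y 0 T] D(10) by simp
    next
      case no: False
      \<comment> \<open>A vertex that can spare both kinds would form a deletable edge with any
        neighbour, in one direction or the other.\<close>
      have excl: "\<not> (?out v \<and> ?in v)" if v: "v \<in> W" for v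
      proof
        assume v': "?out v \<and> ?in v"
        obtain y where "y \<in> W" "y \<noteq> v" "0 < m v y"
          using edge_leaving[OF k I, of "{v}"] sing[OF v] by auto
        then show False using v' v no one D(3)[of v y] by metis
      qed
      define U where "U = {v \<in> W. ?out v}"
      have "U = {} \<or> U = W"
      proof (rule ccontr)
        assume "\<not> ?thesis"
        then have "U \<noteq> {}" "U \<subset> W" by (auto simp: U_def)
        then obtain x y where "x \<in> U" "y \<in> W - U" "0 < m x y"
          using edge_leaving[OF k I] by metis
        then have "x \<in> W" "y \<in> W" "x \<noteq> y" "?out x" "?in y" using one by (auto simp: U_def)
        then show False using no \<open>0 < m x y\<close> by blast
      qed
      then show ?thesis
      proof
        assume "U = W"
        then show ?thesis
          using all_out_solved[OF k I H B W H'] excl by (auto simp: U_def)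
      next
        assume U: "U = {}"
        have 1: "can_out k W m R P (\<lambda>v. - t v) v" "\<not> can_in k W m R P (\<lambda>v. - t v) v" if "v \<in> W" for v
          using U one that by (auto simp: U_def can_swap)
        have 2: "big_slack k W m R P (\<lambda>v. - t v)"
          using B by (auto simp: big_slack_def intro: feasible_swap)
        have 3: "solvable k W m P' R' t' {}"
          if "admissible k W m P' R' t' {} {}" "sum P' W + sum R' W < sum R W + sum P W" for P' R' t'
          using H' that by (simp add: add.commute)
        show ?thesis
          using all_out_solved[OF k admissible_swap[OF I] H 2 W 3 1] by (rule solvable_swap)
      qed
    qed
  qed
qed

text \<open>Lexicographic induction on vertices, edges inside \<open>W\<close>, edges at
  \<open>z\<close>. The last come last because \<open>delete_edge\<close> may increase them and only
  \<open>reclaim\<close> relies on their decrease.\<close>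

lemma admissible_solved:
  fixes W :: "'v set"
  assumes k: "3 \<le> k" and I: "admissible k W m P R t X S"
  shows "solvable k W m P R t S"
proof -
  let ?r = "inv_image (less_than <*lex*> (less_than <*lex*> less_than))
    (\<lambda>(W :: 'v set, m, P, R). (card W, nat (cut_weight m W W), nat (sum P W + sum R W)))"
  have "wf ?r" by (intro wf_inv_image wf_lex_prod wf_less_than)
  then have "\<forall>W m P R t X S. z = (W :: 'v set, m, P, R) \<longrightarrow> admissible k W m P R t X S \<longrightarrow> solvable k W m P R t S" for z
  proof (induction z rule: wf_induct_rule)
    case (less z)
    show ?case
    proof (intro allI impI)
      fix W :: "'v set" and m P R t X S
      assume z: "z = (W, m, P, R)" and I: "admissible k W m P R t X S"
      note D = admissibleD[OF I]
      have H: "smaller_solved k W m"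
        unfolding smaller_solved_def
      proof (intro conjI allI impI; elim conjE)
        fix W' :: "'v set" and m' P' R' t' X' S'
        assume "admissible k W' m' P' R' t' X' S'" "card W' < card W"
        then show "solvable k W' m' P' R' t' S'" using less[of "(W', m', P', R')"] by (auto simp: z)
      next
        fix m' P' R' t' X' S'
        assume "admissible k W m' P' R' t' X' S'" "cut_weight m' W W < cut_weight m W W"
        moreover from this have "0 \<le> cut_weight m' W W" using admissibleD(4) by (intro cut_weight_nonneg) 
        ultimately show "solvable k W m' P' R' t' S'" using less[of "(W, m', P', R')"] by (auto simp: z)
      qed
      have H': "solvable k W m P' R' t' {}"
        if "admissible k W m P' R' t' {} {}" "sum P' W + sum R' W < sum P W + sum R W" for P' R' t'
      proof -
        have "0 \<le> sum P' W + sum R' W" using admissibleD(6,7)[OF that(1)] by (auto intro!: add_nonneg_nonneg sum_nonneg)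
        then show ?thesis using less[of "(W, m, P', R')"] that by (auto simp: z)
      qed
      show "solvable k W m P R t S"
      proof (cases "2 \<le> card W")
        case False
        then have "card W = 1" using D(1,2) by (metis One_nat_def card_eq_0_iff less_2_cases linorder_not_le)
        then obtain v where "W = {v}" by (rule card_1_singletonE)
        then show ?thesis using solvable_singleton[of k v m P R t X S] I k by simp
      next
        case W: True
        show ?thesis
        proof (cases "big_slack k W m P R t")
          case False
          then show ?thesis using contract[OF _ I H] k by (auto simp: big_slack_def)
        next
          case B: True
          consider v where "v \<in> X" | v where "v \<in> S" | "X = {}" "S = {}" by blast
          then show ?thesis
          proof cases
            case 1
            then show ?thesis using exempt_solved[OF k I H B] by blast
          next
            case 2
            then show ?thesis using marked_solved[OF k I H B W] by blast
          next
            case 3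
            then show ?thesis using plain_solved[OF k _ H B H' W] I by simp
          qed
        qed
      qed
    qed
  qed
  then show ?thesis using I by blast
qed

section \<open>Bipartite graphs\<close>

lemma small_residue: "0 < k \<Longrightarrow> \<exists>T. 2 * k dvd T - s \<and> \<bar>T\<bar> \<le> (k :: int)"
proof (intro exI conjI)
  assume k: "0 < k"
  have "(s + k) mod (2 * k) - k - s = - (2 * k * ((s + k) div (2 * k)))"
    using minus_mod_eq_mult_div[of "s + k" "2 * k"] by simp
  then show "2 * k dvd (s + k) mod (2 * k) - k - s" by simp
  show "\<bar>(s + k) mod (2 * k) - k\<bar> \<le> k"
    using pos_mod_sign[of "2 * k" "s + k"] pos_mod_bound[of "2 * k" "s + k"] k by linarith
qed

text \<open>Edges oriented from \<open>X\<close> to the other part are those of the future factor.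
  The sum is the degree in it: outdegree on \<open>X\<close>, indegree elsewhere.\<close>

definition degree_orientation :: "int \<Rightarrow> 'v set \<Rightarrow> ('v \<Rightarrow> 'v \<Rightarrow> int) \<Rightarrow> 'v set \<Rightarrow> ('v \<Rightarrow> 'v \<Rightarrow> int) \<Rightarrow> bool" where
  "degree_orientation k W m X f \<longleftrightarrow> orients W m f \<and>
     (\<forall>v\<in>W. k dvd (\<Sum>u\<in>W. if v \<in> X then f v u else f u v) \<and>
        0 < (\<Sum>u\<in>W. if v \<in> X then f v u else f u v))"

text \<open>The starting configuration: \<open>z\<close> has no edges and every vertex is marked.
  The case assumed here is that every cut below 3k - 3 has a single vertex on one side.\<close>

lemma degree_orientation_nonseparable:
  fixes k :: int
  assumes k: "3 \<le> k" and W: "finite W" "2 \<le> card W"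
    and m: "\<And>u v. m u v = m v u" "\<And>u v. 0 \<le> m u v" "\<And>v. m v v = 0"
    and X: "X \<subseteq> W" "\<And>u v. u \<in> W \<Longrightarrow> v \<in> W \<Longrightarrow> (u \<in> X \<longleftrightarrow> v \<in> X) \<Longrightarrow> m u v = 0"
    and deg: "\<And>A. A \<noteq> {} \<Longrightarrow> A \<subset> W \<Longrightarrow> 2 * k \<le> cut_weight m A (W - A)"
    and ess: "\<And>A. A \<subset> W \<Longrightarrow> 2 \<le> card A \<Longrightarrow> 2 \<le> card (W - A) \<Longrightarrow> 3 * k - 3 \<le> cut_weight m A (W - A)"
  shows "\<exists>f. degree_orientation k W m X f"
proof -
  define d where "d v = (\<Sum>u\<in>W. m v u)" for v
  \<comment> \<open>If s is the degree in the factor, the net outdegree is 2s - d on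
    \<open>X\<close> and d - 2s elsewhere, so k divides s iff it is - d, respectively d, modulo
    2k.\<close>
  define t where "t v = (if v \<in> X then - d v else d v)" for v
  let ?z = "\<lambda>_ :: 'a. 0 :: int"
  have b: "boundary_degree W m ?z ?z A = cut_weight m A (W - A)" for A by (simp add: boundary_degree_def)
  have b1: "boundary_degree W m ?z ?z {v} = d v" if "v \<in> W" for v
    using W(1) m(3) that by (simp add: boundary_degree_single d_def)
  have proper: "{v} \<subset> W" if "v \<in> W" for v using that W(2) by auto
  have d: "2 * k \<le> d v" if "v \<in> W" for v
    using deg[OF _ proper[OF that]] b1[OF that] b by simp
  have "sum t W = sum t X + sum t (W - X)"
    using W(1) X(1) by (simp add: sum.subset_diff add.commute)
  also have "sum t (W - X) = (\<Sum>v\<in>W - X. \<Sum>u\<in>X. m v u)"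
    unfolding t_def d_def using W(1) X
    by (intro sum.cong) (auto intro!: sum.mono_neutral_right)
  also have "\<dots> = (\<Sum>u\<in>X. \<Sum>v\<in>W - X. m u v)"
    by (subst sum.swap) (simp add: m(1))
  also have "\<dots> = (\<Sum>u\<in>X. d u)"
    unfolding d_def using W(1) X by (intro sum.cong sum.mono_neutral_left) auto
  also have "sum t X = - (\<Sum>u\<in>X. d u)" by (simp add: t_def sum_negf)
  finally have t0: "sum t W = 0" by simp
  \<comment> \<open>The witness belongs to factor degree k, which leaves at least k edges outside
    the factor.\<close>
  have slack: "feasible k W m ?z ?z t (2 * k) {v}" if "v \<in> W" for v
    unfolding feasible_def b1[OF that] using d[OF that]
    by (intro exI[of _ "if v \<in> X then 2 * k - d v else d v - 2 * k"]) (auto simp: t_def)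
  have I: "admissible k W m ?z ?z t {} W"
  proof (rule admissibleI)
    show "W \<noteq> {}" using W(2) by auto
    show "even (t v - boundary_degree W m ?z ?z {v})" if "v \<in> W" for v
      using b1[OF that] by (simp add: t_def)
    show "in_bounds k (sum ?z W) (sum ?z W)" using k by (simp add: in_bounds_def)
    show "feasible k W m ?z ?z t (2 * k - 2) A" if A: "A \<noteq> {}" "A \<subset> W" for A
    proof -
      have fA: "finite A" "finite (W - A)" using A(2) W(1) by (auto dest: finite_subset)
      consider v where "A = {v}" | v where "W - A = {v}" | "2 \<le> card A" "2 \<le> card (W - A)"
      proof -
        have "card A \<noteq> 0" "card (W - A) \<noteq> 0" using A fA by auto
        then show thesis using that by (metis One_nat_def card_1_singletonE less_2_cases not_less)
      qed
      then show ?thesis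
      proof cases
        case 1
        then have "feasible k W m ?z ?z t (2 * k) A" using slack A by auto
        then show ?thesis by (rule feasible_lower) simp
      next
        case 2
        then have v: "v \<in> W" "A = W - {v}" using A by auto
        obtain T where T: "2 * k dvd T - t v" "\<bar>T\<bar> \<le> d v - 2 * k"
          using slack[OF v(1)] b1[OF v(1)] by (auto simp: feasible_def)
        have "boundary_degree W m ?z ?z A = d v"
          using boundary_degree_compl[of W m "{v}" ?z ?z, OF W(1) m(1)] v b1[OF v(1)] by simp
        moreover have "sum t A = - t v" using v W(1) t0 by (simp add: sum_diff1)
        moreover have "2 * k dvd - T - - t v" using T(1) dvd_minus_iff[of "2 * k" "T - t v"] by (simp add: algebra_simps)
        ultimately show ?thesis unfolding feasible_def using T(2) by (intro exI[of _ "- T"]) simp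
      next
        case 3
        obtain T where T: "2 * k dvd T - sum t A" "\<bar>T\<bar> \<le> k" using small_residue[of k "sum t A"] k by auto
        let ?c = "cut_weight m A (W - A)"
        have c: "3 * k - 3 \<le> ?c" using ess A 3 by auto
        have "even (sum t A - ?c)"
        proof -
          have "even (\<Sum>v\<in>A. t v - d v)" by (intro dvd_sum) (simp add: t_def)
          moreover have "(\<Sum>v\<in>A. d v) = cut_weight m A A + ?c"
          proof -
            have "(\<Sum>v\<in>A. d v) = cut_weight m A (A \<union> (W - A))"
              using A by (simp add: cut_weight_def d_def Un_absorb1 psubset_imp_subset)
            then show ?thesis using fA by (simp add: cut_weight_Un_right del: Un_Diff_cancel)
          qed
          moreover have "even (cut_weight m A A)" using fA(1) m(1,3) by (rule cut_weight_self_even)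
          ultimately show ?thesis by (simp add: sum_subtractf)
        qed
        moreover have "even (T - sum t A)" using T(1) by (meson dvd_trans dvd_triv_left)
        ultimately have "even (T - ?c)" by simp
        \<comment> \<open>A cut of 3k - 3 edges leaves room for k - 1 only, but then
          \<open>T\<close> has the parity of k - 1 and cannot be \<plusminus> k.\<close>
        then have "\<bar>T\<bar> \<le> ?c - (2 * k - 2)" using c T(2) by presburger
        then show ?thesis using T(1) unfolding feasible_def b by auto
      qed
    qed
  qed (use W m slack t0 in simp_all)
  obtain f where f: "orients W m f"
    "\<And>v. v \<in> W \<Longrightarrow> 2 * k dvd net_outdegree W f v - t v" "\<And>v. v \<in> W \<Longrightarrow> \<bar>net_outdegree W f v\<bar> \<le> d v - 2"
    using admissible_solved[OF k I] b1 by (auto simp: solvable_def)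
  have "k dvd (\<Sum>u\<in>W. if v \<in> X then f v u else f u v) \<and> 0 < (\<Sum>u\<in>W. if v \<in> X then f v u else f u v)"
    if v: "v \<in> W" for v
  proof -
    define s where "s = (\<Sum>u\<in>W. if v \<in> X then f v u else f u v)"
    have "d v = (\<Sum>u\<in>W. f v u + f u v)"
      unfolding d_def using f(1) v by (intro sum.cong) (auto simp: orients_def)
    then have 2: "2 * s = d v + (if v \<in> X then net_outdegree W f v else - net_outdegree W f v)"
      by (simp add: s_def net_outdegree_def sum.distrib sum_subtractf)
    have "2 * k dvd 2 * s"
      unfolding 2 using f(2)[OF v] dvd_minus_iff[of "2 * k" "net_outdegree W f v - t v"]
      by (auto simp: t_def algebra_simps)
    \<comment> \<open>The mark enters next: |net outdegree| \<le> d - 2 is what keeps s away from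
      0.\<close>
    then have "k dvd s" by simp
    moreover have "0 < s" using 2 f(3)[OF v] by (auto split: if_splits)
    ultimately show ?thesis by (simp add: s_def)
  qed
  then show ?thesis using f(1) by (auto simp: degree_orientation_def)
qed

section \<open>Splitting at cut vertices\<close>

definition shares_end :: "'v set \<Rightarrow> ('v \<Rightarrow> 'v \<Rightarrow> int) \<Rightarrow> 'v set \<Rightarrow> 'v \<Rightarrow> bool" where
  "shares_end W m A v \<longleftrightarrow> (\<forall>u\<in>A. \<forall>w\<in>W - A. m u w \<noteq> 0 \<longrightarrow> v = u \<or> v = w)"

lemma shares_end_compl:
  assumes "\<And>u v. m u v = m v u" "A \<subseteq> W" "shares_end W m A v"
  shows "shares_end W m (W - A) v"
  using assms unfolding shares_end_def by (metis DiffD1 DiffD2 Diff_iff)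

text \<open>Within \<open>V\<close> only \<open>v\<close> can have neighbours outside, so whichever
  of \<open>A\<close> and \<open>V - A\<close> avoids \<open>v\<close> has the same cut in
  \<open>V\<close> as in \<open>W\<close>. Both connectivity conditions are thereby inherited by
  \<open>V\<close>.\<close>

lemma block_cut:
  assumes W: "finite W" and m: "\<And>u v. m u v = m v u"
    and V: "V \<subseteq> W" and sep: "\<And>u w. u \<in> V - {v} \<Longrightarrow> w \<in> W - V \<Longrightarrow> m u w = 0"
    and A: "A \<noteq> {}" "A \<subset> V"
  shows "\<exists>A'. A' \<noteq> {} \<and> A' \<subset> W \<and> cut_weight m A (V - A) = cut_weight m A' (W - A') \<and>
    (\<forall>u. shares_end W m A' u \<longrightarrow> shares_end V m A u)"
proof -
  have *: "cut_weight m A (V - A) = cut_weight m A (W - A)" "\<And>u. shares_end W m A u \<Longrightarrow> shares_end V m A u"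
    if "A \<subseteq> V" "v \<notin> A" for A
  proof -
    have "m u w = 0" if "u \<in> A" "w \<in> W - A - (V - A)" for u w
      using that \<open>A \<subseteq> V\<close> \<open>v \<notin> A\<close> by (intro sep) auto
    then show "cut_weight m A (V - A) = cut_weight m A (W - A)"
      unfolding cut_weight_def using W V by (intro sum.cong sum.mono_neutral_left) auto
    show "shares_end V m A u" if "shares_end W m A u" for u
      using that V by (auto simp: shares_end_def)
  qed
  show ?thesis
  proof (cases "v \<in> A")
    case False
    then show ?thesis using A V * by (intro exI[of _ A]) auto
  next
    case True
    have AA: "V - (V - A) = A" using A by auto
    have "cut_weight m A (V - A) = cut_weight m (V - A) (V - (V - A))"
      unfolding AA using m by (rule cut_weight_sym)
    moreover have "shares_end V m A u" if "shares_end W m (V - A) u" for u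
      using shares_end_compl[of m "V - A" V u, OF m] *(2)[of "V - A" u] that True by (auto simp: AA)
    ultimately show ?thesis
      using *(1)[of "V - A"] True A V by (intro exI[of _ "V - A"]) auto
  qed
qed

text \<open>A small cut with two vertices on each side makes the common end of its edges a cut
  vertex. The two parts that overlap in it are oriented by induction and put together.\<close>

lemma degree_orientation_exists:
  fixes k :: int
  assumes k: "3 \<le> k" and W: "finite W" "2 \<le> card W"
    and m: "\<And>u v. m u v = m v u" "\<And>u v. 0 \<le> m u v" "\<And>v. m v v = 0"
    and X: "\<And>u v. u \<in> W \<Longrightarrow> v \<in> W \<Longrightarrow> (u \<in> X \<longleftrightarrow> v \<in> X) \<Longrightarrow> m u v = 0"
    and deg: "\<And>A. A \<noteq> {} \<Longrightarrow> A \<subset> W \<Longrightarrow> 2 * k \<le> cut_weight m A (W - A)"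
    and ess: "\<And>A. A \<noteq> {} \<Longrightarrow> A \<subset> W \<Longrightarrow> cut_weight m A (W - A) < 3 * k - 3 \<Longrightarrow> \<exists>v. shares_end W m A v"
  shows "\<exists>f. degree_orientation k W m X f"
  using W X deg ess
proof (induction "card W" arbitrary: W rule: less_induct)
  case (less W)
  note W = less.prems(1,2) and X = less.prems(3) and deg = less.prems(4) and ess = less.prems(5)
  show ?case
  proof (cases "\<exists>A. A \<subset> W \<and> 2 \<le> card A \<and> 2 \<le> card (W - A) \<and> cut_weight m A (W - A) < 3 * k - 3")
    case False
    \<comment> \<open>\<open>X\<close> stays fixed while \<open>W\<close> shrinks in the induction,
      so it is cut down to \<open>W\<close> only here.\<close>
    have "\<exists>f. degree_orientation k W m (X \<inter> W) f"
    proof (rule degree_orientation_nonseparable[OF k W m _ _ deg])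
      show "m u v = 0" if "u \<in> W" "v \<in> W" "(u \<in> X \<inter> W) = (v \<in> X \<inter> W)" for u v
        using X that by blast
      show "3 * k - 3 \<le> cut_weight m A (W - A)" if "A \<subset> W" "2 \<le> card A" "2 \<le> card (W - A)" for A
        using False that not_less by blast
    qed auto
    then obtain f where "degree_orientation k W m (X \<inter> W) f" ..
    then have "degree_orientation k W m X f" by (simp add: degree_orientation_def)
    then show ?thesis by blast
  next
    case True
    then obtain A0 where A0: "A0 \<subset> W" "2 \<le> card A0" "2 \<le> card (W - A0)" "cut_weight m A0 (W - A0) < 3 * k - 3"
      by auto
    have "A0 \<noteq> {}" using A0 by auto
    then obtain v where v0: "shares_end W m A0 v" using ess A0 by blast
    have "cut_weight m A0 (W - A0) \<noteq> 0" using deg[OF \<open>A0 \<noteq> {}\<close> A0(1)] k by simp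
    then have "\<exists>u\<in>A0. \<exists>w\<in>W - A0. m u w \<noteq> 0"
      unfolding cut_weight_def by (meson sum.neutral)
    then have vW: "v \<in> W" using v0 A0(1) by (auto simp: shares_end_def)
    define A where "A = (if v \<in> A0 then A0 else W - A0)"
    have WA0: "W - (W - A0) = A0" using A0 by auto
    have A: "A \<subset> W" "2 \<le> card A" "2 \<le> card (W - A)" "v \<in> A"
      using A0 vW \<open>A0 \<noteq> {}\<close> by (auto simp: A_def WA0)
    have "shares_end W m A v"
      using v0 shares_end_compl[of m A0 W v, OF m(1) _ v0] A0(1) by (auto simp: A_def)
    \<comment> \<open>Every cut edge meets \<open>v\<close>, and \<open>v\<close> lies in
      \<open>A\<close>, so no other vertex of \<open>A\<close> has a neighbour outside.\<close>
    then have sep: "m u w = 0" if "u \<in> A - {v}" "w \<in> W - A" for u w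
      using that A(4) by (auto simp: shares_end_def)
    define B where "B = W - A"
    define V where "V = insert v B"
    have AB: "W = A \<union> B" "A \<inter> B = {}" "finite A" "finite B" "v \<notin> B"
      using A W(1) by (auto simp: B_def dest: finite_subset)
    have IH: "\<exists>f. degree_orientation k U m X f"
      if U: "U \<subset> W" "2 \<le> card U" and sU: "\<And>u w. u \<in> U - {v} \<Longrightarrow> w \<in> W - U \<Longrightarrow> m u w = 0" for U
    proof (rule less.hyps)
      show "card U < card W" using U(1) W(1) by (rule psubset_card_mono[rotated])
      show "finite U" "2 \<le> card U" using U W(1) by (auto dest: finite_subset)
      show "m u w = 0" if "u \<in> U" "w \<in> U" "(u \<in> X) = (w \<in> X)" for u w
        using X that U(1) by blast
      show "2 * k \<le> cut_weight m C (U - C)" if C: "C \<noteq> {}" "C \<subset> U" for C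
      proof -
        have "\<exists>C'. C' \<noteq> {} \<and> C' \<subset> W \<and> cut_weight m C (U - C) = cut_weight m C' (W - C') \<and>
            (\<forall>u. shares_end W m C' u \<longrightarrow> shares_end U m C u)"
          by (rule block_cut[OF W(1) m(1) psubset_imp_subset[OF U(1)] sU C])
        then obtain C' where "C' \<noteq> {}" "C' \<subset> W" "cut_weight m C (U - C) = cut_weight m C' (W - C')" by blast
        then show ?thesis using deg[of C'] by simp
      qed
      show "\<exists>v. shares_end U m C v" if C: "C \<noteq> {}" "C \<subset> U" and c: "cut_weight m C (U - C) < 3 * k - 3" for C
      proof -
        have "\<exists>C'. C' \<noteq> {} \<and> C' \<subset> W \<and> cut_weight m C (U - C) = cut_weight m C' (W - C') \<and>
            (\<forall>u. shares_end W m C' u \<longrightarrow> shares_end U m C u)"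
          by (rule block_cut[OF W(1) m(1) psubset_imp_subset[OF U(1)] sU C])
        then obtain C' where "C' \<noteq> {}" "C' \<subset> W" "cut_weight m C (U - C) = cut_weight m C' (W - C')"
          "\<And>u. shares_end W m C' u \<Longrightarrow> shares_end U m C u" by blast
        then show ?thesis using ess[of C'] c by auto
      qed
    qed
    obtain f1 where f1: "degree_orientation k A m X f1"
      using IH[OF A(1,2) sep] by auto
    have V1: "V \<subset> W"
    proof -
      have "A \<noteq> {v}" using A(2) by auto
      then show ?thesis using A AB by (auto simp: V_def)
    qed
    have V2: "2 \<le> card V" using A(3) AB(4,5) unfolding V_def B_def[symmetric] by simp
    have V3: "m u w = 0" if "u \<in> V - {v}" "w \<in> W - V" for u w
    proof -
      have "w \<in> A - {v}" "u \<in> W - A" using that unfolding V_def B_def by blast+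
      then have "m w u = 0" by (rule sep)
      then show ?thesis using m(1)[of u w] by simp
    qed
    obtain f2 where f2: "degree_orientation k V m X f2"
      using IH[OF V1 V2 V3] by auto
    define f where "f u w = (if u \<in> A \<and> w \<in> A then f1 u w else if u \<in> V \<and> w \<in> V then f2 u w else 0)" for u w
    have o: "orients A m f1" "orients V m f2" using f1 f2 by (auto simp: degree_orientation_def)
    have f2v: "f2 v v = 0" using o(2) m(3)[of v] by (auto simp: orients_def V_def)
    have "orients W m f"
      unfolding orients_def
    proof (intro ballI)
      fix u w assume uw: "u \<in> W" "w \<in> W"
      show "0 \<le> f u w \<and> f u w + f w u = m u w"
      proof (cases "u \<in> A \<and> w \<in> A \<or> u \<in> V \<and> w \<in> V")
        case True
        then show ?thesis using o by (auto simp: f_def orients_def)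
      next
        case False
        then consider "u \<in> A - {v}" "w \<in> W - A" | "w \<in> A - {v}" "u \<in> W - A"
          using uw unfolding V_def B_def by blast
        then have "m u w = 0"
        proof cases
          case 2
          then have "m w u = 0" by (rule sep)
          then show ?thesis using m(1)[of u w] by simp
        qed (rule sep)
        then show ?thesis using False by (auto simp: f_def)
      qed
    qed
    moreover define s where "s U g x = (\<Sum>u\<in>U. if x \<in> X then g x u else g u x)" for U and g :: "'a \<Rightarrow> 'a \<Rightarrow> int" and x
    have sW: "s W f x = s A f x + s B f x" for x
      unfolding s_def AB(1) using AB by (intro sum.union_disjoint)
    have sV: "s V f2 x = (if x \<in> X then f2 x v else f2 v x) + s B f2 x" for x
      unfolding s_def V_def using AB by simp
    have s1: "s W f x = s A f1 x" if "x \<in> A" "x \<noteq> v" for x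
    proof -
      have "s A f x = s A f1 x" unfolding s_def using that by (intro sum.cong) (auto simp: f_def)
      moreover have "s B f x = 0" unfolding s_def using that AB by (intro sum.neutral) (auto simp: f_def V_def)
      ultimately show ?thesis using sW by simp
    qed
    have s2: "s W f x = s V f2 x" if "x \<in> B" for x
    proof -
      have xA: "x \<notin> A" using that AB by auto
      have "s B f x = s B f2 x" unfolding s_def using that xA AB by (intro sum.cong) (auto simp: f_def V_def)
      moreover have "s A f x = (if x \<in> X then f2 x v else f2 v x)"
        unfolding s_def using that xA AB A(4)
        by (subst sum_eq_single[of A v]) (auto simp: f_def V_def)
      ultimately show ?thesis using sW sV by simp
    qed
    \<comment> \<open>\<open>v\<close> belongs to both parts, but its own summand in
      \<open>V\<close> is \<open>f2 v v = 0\<close>, so nothing is counted twice.\<close>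
    have s3: "s W f v = s A f1 v + s V f2 v"
    proof -
      have "s A f v = s A f1 v" unfolding s_def using A(4) by (intro sum.cong) (auto simp: f_def)
      moreover have "s B f v = s B f2 v" unfolding s_def using AB by (intro sum.cong) (auto simp: f_def V_def)
      ultimately show ?thesis using sW sV f2v by simp
    qed
    have g1: "k dvd s A f1 x \<and> 0 < s A f1 x" if "x \<in> A" for x
      using f1 that by (simp add: degree_orientation_def s_def)
    have g2: "k dvd s V f2 x \<and> 0 < s V f2 x" if "x \<in> V" for x
      using f2 that by (simp add: degree_orientation_def s_def)
    have "k dvd s W f x \<and> 0 < s W f x" if "x \<in> W" for x
    proof -
      consider "x = v" | "x \<in> A" "x \<noteq> v" | "x \<in> B" using \<open>x \<in> W\<close> AB(1) by blast
      then show ?thesis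
        using g1[of x] g2[of x] s1[of x] s2[of x] s3 A(4) by cases (auto simp: V_def)
    qed
    ultimately have "degree_orientation k W m X f"
      by (simp add: degree_orientation_def s_def)
    then show ?thesis by blast
  qed
qed

section \<open>Multigraphs and their multiplicity functions\<close>

definition between :: "('v, 'e) graph \<Rightarrow> 'v \<Rightarrow> 'v \<Rightarrow> 'e set" where
  "between G u v = {e \<in> edges G. u \<noteq> v \<and> ends G e = {#u, v#}}"

text \<open>Loops count as 0: they lie in no cut, and the orientation results ask for a zero
  diagonal.\<close>

definition edge_mult :: "('v, 'e) graph \<Rightarrow> 'v \<Rightarrow> 'v \<Rightarrow> int" where
  "edge_mult G u v = int (card (between G u v))"

lemma between_sym: "between G u v = between G v u"
  unfolding between_def by (auto simp: add_mset_commute)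

lemma finite_between: "multigraph G \<Longrightarrow> finite (between G u v)"
  by (auto simp: between_def multigraph_def)

lemma pair_mset_eq: "{#a, b#} = {#c, d#} \<longleftrightarrow> a = c \<and> b = d \<or> a = d \<and> b = c"
  by (auto simp: add_eq_conv_ex)

lemma between_disjoint:
  assumes "X \<inter> Y = {}" "p \<in> X \<times> Y" "q \<in> X \<times> Y" "p \<noteq> q"
  shows "between G (fst p) (snd p) \<inter> between G (fst q) (snd q) = {}"
proof -
  obtain a b c d where pq: "p = (a, b)" "q = (c, d)" by (metis surj_pair)
  have "{#a, b#} \<noteq> {#c, d#}"
    using assms pq unfolding pair_mset_eq by blast
  then show ?thesis by (auto simp: between_def pq)
qed

lemma edge_cut_eq_between:
  assumes "multigraph G"
  shows "edge_cut G A = (\<Union>p\<in>A \<times> (verts G - A). between G (fst p) (snd p))"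
proof -
  have in_verts: "w \<in> verts G" if "e \<in> edges G" "ends G e = {#u, w#}" for e u w
  proof -
    have "set_mset (ends G e) \<subseteq> verts G" using assms that(1) by (auto simp: multigraph_def)
    then show ?thesis using that(2) by simp
  qed
  have "e \<in> edge_cut G A \<longleftrightarrow> (\<exists>u\<in>A. \<exists>w\<in>verts G - A. e \<in> between G u w)" for e
  proof
    assume "e \<in> edge_cut G A"
    then obtain u w where "e \<in> edges G" "ends G e = {#u, w#}" "u \<in> A" "w \<notin> A"
      by (auto simp: edge_cut_def)
    then show "\<exists>u\<in>A. \<exists>w\<in>verts G - A. e \<in> between G u w"
      using in_verts by (intro bexI[of _ u] bexI[of _ w]) (auto simp: between_def)
  qed (auto simp: edge_cut_def between_def)
  then show ?thesis by (simp add: set_eq_iff Bex_def)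
qed

lemma card_edge_cut:
  assumes G: "multigraph G" and A: "A \<subseteq> verts G"
  shows "int (card (edge_cut G A)) = cut_weight (edge_mult G) A (verts G - A)"
proof -
  have fin: "finite A" "finite (verts G - A)"
    using G A by (auto simp: multigraph_def dest: finite_subset)
  have "card (edge_cut G A) = (\<Sum>p\<in>A \<times> (verts G - A). card (between G (fst p) (snd p)))"
    unfolding edge_cut_eq_between[OF G]
  proof (rule card_UN_disjoint)
    show "\<forall>p\<in>A \<times> (verts G - A). \<forall>q\<in>A \<times> (verts G - A). p \<noteq> q \<longrightarrow>
        between G (fst p) (snd p) \<inter> between G (fst q) (snd q) = {}"
      using between_disjoint[of A "verts G - A" _ _ G] by simp
  qed (use fin finite_between[OF G] in auto)
  then show ?thesis
    by (simp add: cut_weight_def edge_mult_def sum.cartesian_product case_prod_beta)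
qed

lemma degree_subgraph:
  assumes fin: "finite X" "finite Y" and XY: "X \<inter> Y = {}"
    and C: "\<And>x y. x \<in> X \<Longrightarrow> y \<in> Y \<Longrightarrow> C x y \<subseteq> between G x y \<and> finite (C x y)"
  shows "degree (G\<lparr>edges := \<Union>p\<in>X \<times> Y. C (fst p) (snd p)\<rparr>) v
    = (\<Sum>x\<in>X. \<Sum>y\<in>Y. card (C x y) * (of_bool (x = v) + of_bool (y = v)))"
proof -
  let ?H = "G\<lparr>edges := \<Union>p\<in>X \<times> Y. C (fst p) (snd p)\<rparr>"
  have "degree ?H v = (\<Sum>e\<in>(\<Union>p\<in>X \<times> Y. C (fst p) (snd p)). count (ends G e) v)"
    by (simp add: degree_def)
  also have "\<dots> = (\<Sum>p\<in>X \<times> Y. \<Sum>e\<in>C (fst p) (snd p). count (ends G e) v)"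
  proof (rule sum.UNION_disjoint)
    show "\<forall>p\<in>X \<times> Y. \<forall>q\<in>X \<times> Y. p \<noteq> q \<longrightarrow> C (fst p) (snd p) \<inter> C (fst q) (snd q) = {}"
    proof (intro ballI impI)
      fix p q assume "p \<in> X \<times> Y" "q \<in> X \<times> Y" "p \<noteq> q"
      moreover from this have "C (fst p) (snd p) \<subseteq> between G (fst p) (snd p)" "C (fst q) (snd q) \<subseteq> between G (fst q) (snd q)"
        using C by (simp_all add: mem_Times_iff)
      ultimately show "C (fst p) (snd p) \<inter> C (fst q) (snd q) = {}"
        using between_disjoint[OF XY, of p q G] by blast
    qed
  qed (use fin C in auto)
  also have "\<dots> = (\<Sum>p\<in>X \<times> Y. card (C (fst p) (snd p)) * (of_bool (fst p = v) + of_bool (snd p = v)))"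
  proof (rule sum.cong[OF refl])
    fix p assume "p \<in> X \<times> Y"
    then have "C (fst p) (snd p) \<subseteq> between G (fst p) (snd p)" using C[of "fst p" "snd p"] by auto
    then have "count (ends G e) v = of_bool (fst p = v) + of_bool (snd p = v)" if "e \<in> C (fst p) (snd p)" for e
      using that by (auto simp: between_def)
    then show "(\<Sum>e\<in>C (fst p) (snd p). count (ends G e) v)
        = card (C (fst p) (snd p)) * (of_bool (fst p = v) + of_bool (snd p = v))"
      by simp
  qed
  finally show ?thesis by (simp add: sum.cartesian_product case_prod_beta)
qed

text \<open>The orientation tells only how many of the edges between \<open>x\<close> and
  \<open>y\<close> go from \<open>X\<close> to \<open>Y\<close>; any set \<open>C x y\<close> of
  that many parallel edges will do for the factor.\<close>

lemma bipartite_modulo_factor: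
  fixes G :: "('v, 'e) graph" and k :: nat
  assumes G: "multigraph G" and V: "2 \<le> card (verts G)" and k: "3 \<le> k"
    and bip: "bipartite G" and conn: "edge_connected (2 * k) G"
    and ess: "essentially_edge_connected (3 * k - 3) G"
  shows "\<exists>H. factor_of H G \<and> bipartite H \<and> modulo_regular k H"
proof -
  obtain X Y where XY: "X \<union> Y = verts G" "X \<inter> Y = {}"
    "\<And>e. e \<in> edges G \<Longrightarrow> \<exists>x\<in>X. \<exists>y\<in>Y. ends G e = {#x, y#}"
    using bip by (auto simp: bipartite_def)
  let ?W = "verts G"
  have fW: "finite ?W" "finite X" "finite Y" using G XY(1) finite_subset[of X "verts G"] finite_subset[of Y "verts G"]
    by (auto simp: multigraph_def)
  have m: "edge_mult G u v = edge_mult G v u" "0 \<le> edge_mult G u v" "edge_mult G v v = 0" for u v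
    using between_sym[of G u v] by (simp_all add: edge_mult_def between_def)
  have bX: "between G u v = {}" if "u \<in> X \<longleftrightarrow> v \<in> X" for u v
  proof -
    have False if e: "e \<in> between G u v" for e
    proof -
      have "e \<in> edges G" "ends G e = {#u, v#}" using e by (auto simp: between_def)
      then obtain x y where "x \<in> X" "y \<in> Y" "{#u, v#} = {#x, y#}" using XY(3) by metis
      then show False using \<open>u \<in> X \<longleftrightarrow> v \<in> X\<close> XY(2) by (auto simp: pair_mset_eq)
    qed
    then show ?thesis by auto
  qed
  have "\<exists>f. degree_orientation (int k) ?W (edge_mult G) X f"
  proof (rule degree_orientation_exists)
    show "3 \<le> int k" using k by simp
    show "finite ?W" by fact
    show "2 \<le> card ?W" by fact
    show "edge_mult G u v = 0" if "(u \<in> X) = (v \<in> X)" for u v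
      using bX[OF that] by (simp add: edge_mult_def)
    show "2 * int k \<le> cut_weight (edge_mult G) A (?W - A)" if "A \<noteq> {}" "A \<subset> ?W" for A
    proof -
      have "2 * k \<le> card (edge_cut G A)" using conn that by (simp add: edge_connected_def)
      then show ?thesis using card_edge_cut[OF G, of A] that by auto
    qed
    show "\<exists>v. shares_end ?W (edge_mult G) A v"
      if A: "A \<noteq> {}" "A \<subset> ?W" and c: "cut_weight (edge_mult G) A (?W - A) < 3 * int k - 3" for A
    proof -
      have "card (edge_cut G A) < 3 * k - 3"
        using c card_edge_cut[OF G, of A] A k by auto
      then obtain v where v: "\<forall>e\<in>edge_cut G A. v \<in># ends G e"
        using ess A unfolding essentially_edge_connected_def by metis
      have "v = u \<or> v = w" if uw: "u \<in> A" "w \<in> ?W - A" "edge_mult G u w \<noteq> 0" for u w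
      proof -
        have "between G u w \<noteq> {}" using uw(3) by (auto simp: edge_mult_def)
        then obtain e where e: "e \<in> between G u w" by blast
        then have "e \<in> edge_cut G A" using uw(1,2) by (auto simp: between_def edge_cut_def)
        then show ?thesis using v e by (auto simp: between_def)
      qed
      then show ?thesis by (auto simp: shares_end_def)
    qed
  qed (rule m)+
  then obtain f where f: "orients ?W (edge_mult G) f"
    "\<And>v. v \<in> ?W \<Longrightarrow> int k dvd (\<Sum>u\<in>?W. if v \<in> X then f v u else f u v)"
    "\<And>v. v \<in> ?W \<Longrightarrow> 0 < (\<Sum>u\<in>?W. if v \<in> X then f v u else f u v)"
    by (auto simp: degree_orientation_def)
  have fb: "0 \<le> f u v" "f u v \<le> edge_mult G u v" if "u \<in> ?W" "v \<in> ?W" for u v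
  proof -
    have "0 \<le> f u v" "0 \<le> f v u" "f u v + f v u = edge_mult G u v" using f(1) that by (auto simp: orients_def)
    then show "0 \<le> f u v" "f u v \<le> edge_mult G u v" by auto
  qed
  have f0: "f u v = 0" if "u \<in> ?W" "v \<in> ?W" "(u \<in> X) = (v \<in> X)" for u v
    using fb[OF that(1,2)] bX[OF that(3)] by (simp add: edge_mult_def)
  have "\<exists>C. C \<subseteq> between G x y \<and> int (card C) = f x y" if "x \<in> X" "y \<in> Y" for x y
  proof -
    have b: "0 \<le> f x y" "f x y \<le> edge_mult G x y" using fb[of x y] that XY(1) by auto
    then have "nat (f x y) \<le> card (between G x y)" by (simp add: edge_mult_def)
    then obtain C where "C \<subseteq> between G x y" "card C = nat (f x y)" by (rule obtain_subset_with_card_n)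
    then show ?thesis using b(1) by auto
  qed
  then obtain C where C: "\<And>x y. x \<in> X \<Longrightarrow> y \<in> Y \<Longrightarrow> C x y \<subseteq> between G x y \<and> int (card (C x y)) = f x y"
    by metis
  have Cf: "C x y \<subseteq> between G x y \<and> finite (C x y)" if "x \<in> X" "y \<in> Y" for x y
    using C[OF that] finite_between[OF G, of x y] finite_subset by blast
  define H where "H = G\<lparr>edges := \<Union>p\<in>X \<times> Y. C (fst p) (snd p)\<rparr>"
  have HG: "verts H = verts G" "ends H = ends G" "edges H \<subseteq> edges G"
    using C by (fastforce simp: H_def between_def)+
  have "multigraph H"
    using G HG by (auto simp: multigraph_def dest: finite_subset)
  then have "factor_of H G" using HG by (simp add: factor_of_def)
  moreover have "bipartite H"
    unfolding bipartite_def using XY HG by (intro exI[of _ X] exI[of _ Y]) auto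
  moreover have "modulo_regular k H"
  proof -
    have "int (degree H v) = (\<Sum>u\<in>?W. if v \<in> X then f v u else f u v)" if v: "v \<in> ?W" for v
    proof -
      have d: "int (degree H v) = (\<Sum>x\<in>X. \<Sum>y\<in>Y. f x y * (of_bool (x = v) + of_bool (y = v)))"
      proof -
        have "degree H v = (\<Sum>x\<in>X. \<Sum>y\<in>Y. card (C x y) * (of_bool (x = v) + of_bool (y = v)))"
          unfolding H_def using fW(2,3) XY(2) Cf by (rule degree_subgraph)
        then have "int (degree H v) = (\<Sum>x\<in>X. \<Sum>y\<in>Y. int (card (C x y)) * (of_bool (x = v) + of_bool (y = v)))"
          by simp
        also have "\<dots> = (\<Sum>x\<in>X. \<Sum>y\<in>Y. f x y * (of_bool (x = v) + of_bool (y = v)))"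
          using C by (intro sum.cong) simp_all
        finally show ?thesis .
      qed
      show ?thesis
      proof (cases "v \<in> X")
        case True
        then have "v \<notin> Y" using XY(2) by auto
        have "(\<Sum>x\<in>X. \<Sum>y\<in>Y. f x y * (of_bool (x = v) + of_bool (y = v)))
            = (\<Sum>y\<in>Y. f v y * (of_bool (v = v) + of_bool (y = v)))"
          using True fW \<open>v \<notin> Y\<close> by (intro sum_eq_single) (auto intro!: sum.neutral)
        also have "\<dots> = (\<Sum>y\<in>Y. f v y)" using \<open>v \<notin> Y\<close> by (intro sum.cong) auto
        also have "\<dots> = (\<Sum>u\<in>?W. f v u)"
          using XY(1,2) fW True by (intro sum.mono_neutral_left) (auto intro!: f0)
        finally show ?thesis using d True by simp
      next
        case False
        then have vY: "v \<in> Y" using XY(1) v by auto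
        have "(\<Sum>x\<in>X. \<Sum>y\<in>Y. f x y * (of_bool (x = v) + of_bool (y = v)))
            = (\<Sum>y\<in>Y. \<Sum>x\<in>X. f x y * (of_bool (x = v) + of_bool (y = v)))"
          by (rule sum.swap)
        also have "\<dots> = (\<Sum>x\<in>X. f x v * (of_bool (x = v) + of_bool (v = v)))"
          using vY fW False by (intro sum_eq_single) (auto intro!: sum.neutral)
        also have "\<dots> = (\<Sum>x\<in>X. f x v)" using False by (intro sum.cong) auto
        also have "\<dots> = (\<Sum>u\<in>?W. f u v)"
          using XY(1,2) fW vY False by (intro sum.mono_neutral_left) (auto intro!: f0)
        finally show ?thesis using d False by simp
      qed
    qed
    then have "int k dvd int (degree H v) \<and> 0 < int (degree H v)" if "v \<in> ?W" for v
      using f(2,3)[OF that] that by simp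
    then show ?thesis using HG by (simp add: modulo_regular_def)
  qed
  ultimately show ?thesis by blast
qed

section \<open>Maximum cuts\<close>

lemma mem_edge_cut:
  assumes "multigraph G" "e \<in> edges G" "ends G e = {#a, b#}"
  shows "e \<in> edge_cut G A \<longleftrightarrow> (a \<in> A) \<noteq> (b \<in> A)"
  using assms by (auto simp: edge_cut_def pair_mset_eq)

lemma multigraph_ends:
  assumes "multigraph G" "e \<in> edges G"
  obtains a b where "ends G e = {#a, b#}" "a \<in> verts G" "b \<in> verts G"
proof -
  have "size (ends G e) = 2" "set_mset (ends G e) \<subseteq> verts G"
    using assms by (auto simp: multigraph_def)
  moreover from this obtain a N where N: "ends G e = add_mset a N"
    using size_eq_Suc_imp_eq_union[of "ends G e" 1] by auto
  ultimately have "size N = 1" by simp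
  then obtain b where "N = {#b#}" using size_1_singleton_mset by metis
  then show thesis using that N \<open>set_mset (ends G e) \<subseteq> verts G\<close> by auto
qed

text \<open>Moving the vertices of \<open>A\<close> to the other side of a maximum cut swaps, among
  the edges leaving \<open>A\<close>, those in the cut with those outside it. By maximality at least
  half of them are in the cut.\<close>

lemma max_cut_subgraph:
  fixes G :: "('v, 'e) graph"
  assumes G: "multigraph G"
  obtains B where "multigraph B" "verts B = verts G" "ends B = ends G" "edges B \<subseteq> edges G" "bipartite B"
    "\<forall>A. card (edge_cut G A) \<le> 2 * card (edge_cut B A) \<and> edge_cut B A \<subseteq> edge_cut G A"
proof -
  have fE: "finite (edges G)" and fV: "finite (verts G)" using G by (auto simp: multigraph_def)
  have fc: "finite (edge_cut G A)" for A using fE by (simp add: edge_cut_def)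
  let ?N = "(\<lambda>Z. card (edge_cut G Z)) ` Pow (verts G)"
  have N: "finite ?N" using fV by simp
  then have "Max ?N \<in> ?N" by (intro Max_in) auto
  then obtain X where "X \<subseteq> verts G" "Max ?N = card (edge_cut G X)" by auto
  then have X: "X \<subseteq> verts G" "\<And>Z. Z \<subseteq> verts G \<Longrightarrow> card (edge_cut G Z) \<le> card (edge_cut G X)"
    using Max_ge[OF N] by auto
  define B where "B = G\<lparr>edges := edge_cut G X\<rparr>"
  have B: "verts B = verts G" "ends B = ends G" "edges B = edge_cut G X" by (simp_all add: B_def)
  have sub: "edge_cut G X \<subseteq> edges G" by (auto simp: edge_cut_def)
  have cutB: "edge_cut B A = edge_cut G X \<inter> edge_cut G A" for A
    using B sub by (auto simp: edge_cut_def)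
  have "card (edge_cut G A) \<le> 2 * card (edge_cut B A)" for A
  proof -
    \<comment> \<open>The symmetric difference of \<open>X\<close> and \<open>A\<close>, whose edge
      cut is the symmetric difference of the two cuts.\<close>
    define Z where "Z = {v \<in> verts G. (v \<in> X) \<noteq> (v \<in> A)}"
    have "edge_cut G Z = (edge_cut G X - edge_cut G A) \<union> (edge_cut G A - edge_cut G X)"
    proof (rule set_eqI)
      fix e
      show "e \<in> edge_cut G Z \<longleftrightarrow> e \<in> (edge_cut G X - edge_cut G A) \<union> (edge_cut G A - edge_cut G X)"
      proof (cases "e \<in> edges G")
        case True
        then obtain a b where ab: "ends G e = {#a, b#}" "a \<in> verts G" "b \<in> verts G"
          by (rule multigraph_ends[OF G])
        then show ?thesis using mem_edge_cut[OF G True ab(1)] by (auto simp: Z_def)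
      qed (auto simp: edge_cut_def)
    qed
    then have "card (edge_cut G Z) = card (edge_cut G X - edge_cut G A) + card (edge_cut G A - edge_cut G X)"
      using fc by (simp add: card_Un_disjoint Diff_disjoint Int_commute disjoint_iff)
    moreover have "card (edge_cut G Z) \<le> card (edge_cut G X)" by (rule X(2)) (auto simp: Z_def)
    moreover have "card (edge_cut G X) = card (edge_cut G X \<inter> edge_cut G A) + card (edge_cut G X - edge_cut G A)"
      "card (edge_cut G A) = card (edge_cut G A \<inter> edge_cut G X) + card (edge_cut G A - edge_cut G X)"
      using fc by (simp_all add: card_Int_Diff)
    ultimately show ?thesis by (simp add: cutB Int_commute)
  qed
  moreover have "multigraph B" using G B sub by (auto simp: multigraph_def dest: finite_subset)
  moreover have "bipartite B"
    unfolding bipartite_def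
  proof (intro exI conjI ballI)
    show "X \<union> (verts G - X) = verts B" using X(1) B by auto
    fix e assume "e \<in> edges B"
    then obtain u w where "e \<in> edges G" "ends G e = {#u, w#}" "u \<in> X" "w \<notin> X" using B by (auto simp: edge_cut_def)
    moreover from this have "w \<in> verts G" using G by (auto simp: multigraph_def)
    ultimately show "\<exists>x\<in>X. \<exists>y\<in>verts G - X. ends B e = {#x, y#}" using B by auto
  qed simp
  ultimately show thesis using that[of B] B sub cutB by auto
qed

theorem theorem6p3:
  fixes G :: "('v, 'e) graph" and k :: nat
  assumes "multigraph G" and "card (verts G) \<ge> 2" and "k \<ge> 3"
  shows "(edge_connected (4 * k - 1) G \<and> essentially_edge_connected (6 * k - 7) G
            \<longrightarrow> (\<exists>H. factor_of H G \<and> bipartite H \<and> modulo_regular k H))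
       \<and> (bipartite G \<and> edge_connected (2 * k) G \<and> essentially_edge_connected (3 * k - 3) G
            \<longrightarrow> (\<exists>H. factor_of H G \<and> bipartite H \<and> modulo_regular k H))"
proof (intro conjI impI; elim conjE)
  assume conn: "edge_connected (4 * k - 1) G" and ess: "essentially_edge_connected (6 * k - 7) G"
  obtain B where B: "multigraph B" "verts B = verts G" "ends B = ends G" "edges B \<subseteq> edges G" "bipartite B"
    and cut: "\<forall>A. card (edge_cut G A) \<le> 2 * card (edge_cut B A) \<and> edge_cut B A \<subseteq> edge_cut G A"
    by (rule max_cut_subgraph[OF assms(1)])
  have half: "card (edge_cut G A) \<le> 2 * card (edge_cut B A)" and sub: "edge_cut B A \<subseteq> edge_cut G A" for A
    using cut by auto
  have "edge_connected (2 * k) B"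
    unfolding edge_connected_def
  proof (intro allI impI)
    fix A assume "A \<noteq> {} \<and> A \<subset> verts B"
    then have "4 * k - 1 \<le> card (edge_cut G A)" using conn B(2) by (simp add: edge_connected_def)
    \<comment> \<open>Half of 4k - 1, rounded up, is 2k.\<close>
    then show "2 * k \<le> card (edge_cut B A)" using half[of A] assms(3) by linarith
  qed
  moreover have "essentially_edge_connected (3 * k - 3) B"
    unfolding essentially_edge_connected_def
  proof (intro allI impI)
    fix A assume A: "A \<noteq> {} \<and> A \<subset> verts B \<and> card (edge_cut B A) < 3 * k - 3"
    \<comment> \<open>At most 3k - 4 edges in \<open>B\<close> mean at most 6k - 8 in
      \<open>G\<close>.\<close>
    then have "card (edge_cut G A) < 6 * k - 7" using half[of A] by linarith
    then obtain v where "v \<in> verts G" "\<forall>e\<in>edge_cut G A. v \<in># ends G e"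
      using ess A B(2) unfolding essentially_edge_connected_def by metis
    then show "\<exists>v\<in>verts B. \<forall>e\<in>edge_cut B A. v \<in># ends B e"
      unfolding B(2,3) using sub[of A] by blast
  qed
  ultimately obtain H where "factor_of H B" "bipartite H" "modulo_regular k H"
    using bipartite_modulo_factor[of B k] B assms(2,3) by auto
  moreover from this have "factor_of H G" using B by (auto simp: factor_of_def)
  ultimately show "\<exists>H. factor_of H G \<and> bipartite H \<and> modulo_regular k H" by blast
next
  assume "bipartite G" "edge_connected (2 * k) G" "essentially_edge_connected (3 * k - 3) G"
  then show "\<exists>H. factor_of H G \<and> bipartite H \<and> modulo_regular k H"
    using bipartite_modulo_factor[of G k] assms by blast
qed

end
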